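(* Let $\Gamma$ be a group with a linear representation $\rho:\Gamma\to GL(\mathbb{F}^d)$ over a field $\mathbb{F}$, let $1\le k\le d$, and let $(G=(V,E),\psi)$ be a finite $\Gamma$-gain graph. Then there exist vectors $\{p_{e,i}\in\mathbb{K}^d\mid e\in E,1\le i\le k\}$ such that the linear matroid on $E$ represented by $e\mapsto\hat x^{(k)}_{e,\psi}$ equals $\mathbf M(f_{\rho^{(k)}})$; that is, for every $F\subseteq E$, the family $\{\hat x^{(k)}_{e,\psi}\mid e\in F\}$ is linearly independent over $\mathbb{K}$ if and only if $|X|\le f_{\rho^{(k)}}(X)$ for every nonempty $X\subseteq F$.
   Context: $\mathbb{K}$ is an extension field of $\mathbb{F}$ containing sufficiently many elements algebraically independent over $\mathbb{F}$. $\bigwedge^k\mathbb{K}^d$ is the $k$-th exterior power; $\rho^{(k)}:\Gamma\to GL(\bigwedge^k\mathbb{F}^d)$ is the representation with $\rho^{(k)}(\gamma)(v_1\wedge\cdots\wedge v_k)=\rho(\gamma)v_1\wedge\cdots\wedge\rho(\gamma)v_k$. Let $D=\binom dk$. A $\Gamma$-gain graph: $G$ finite directed graph (loops, parallel edges allowed), $\psi:E\to\Gamma$, $\psi_e=\psi(e)$, reversing an edge inverts its gain; walk gains are ordered products with inverses for backward edges. For connected $X\subseteq E$, $\langle X\rangle$ = subgroup of gains of closed walks at a vertex of $V(X)$ using only edges of $X$. $V(F)$, $C(F)$ (edge sets of connected components of $(V(F),F)$), $c(F)=|C(F)|$. $d_{\rho^{(k)}}(Y)=\dim_{\mathbb{F}}\operatorname{span}\{\operatorname{image}(\rho^{(k)}(\gamma)-I_D)\mid\gamma\in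 Y\}$ for $Y\subseteq\Gamma$, and $f_{\rho^{(k)}}(F)=D|V(F)|-D\,c(F)+\sum_{X\in C(F)}d_{\rho^{(k)}}(\langle X\rangle)$. $\hat x^{(k)}_{e,\psi}\in(\bigwedge^k\mathbb{K}^d)^V$: for a non-loop edge $e$ from $i$ to $j$, $\hat x(i)=-\rho(\psi_e)p_{e,1}\wedge\cdots\wedge\rho(\psi_e)p_{e,k}$, $\hat x(j)=p_{e,1}\wedge\cdots\wedge p_{e,k}$, $\hat x(v)=0$ otherwise; for a loop $e$ at $i$, $\hat x(i)=\rho(\psi_e)p_{e,1}\wedge\cdots\wedge\rho(\psi_e)p_{e,k}-p_{e,1}\wedge\cdots\wedge p_{e,k}$, $\hat x(v)=0$ otherwise. *)

theory Defs
  imports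
    "Graph_Theory.Digraph"
    "HOL-Algebra.Group"
    "HOL-Library.Function_Algebras"
    "HOL-Library.Poly_Mapping"
    "Jordan_Normal_Form.Determinant"
    "Jordan_Normal_Form.DL_Missing_Sublist"
begin

section \<open>Exterior powers in coordinates\<close>

text \<open>
  The \<open>k\<close>-th exterior power of the space of \<open>d\<close>-dimensional coordinate vectors has the basis
  \<open>e\<^sub>S = e\<^bsub>s\<^sub>0\<^esub> \<and> \<dots> \<and> e\<^bsub>s\<^bsub>k-1\<^esub>\<^esub>\<close>, where \<open>S = {s\<^sub>0 < \<dots> < s\<^bsub>k-1\<^esub>}\<close> ranges over the \<open>k\<close>-element
  subsets of \<open>{0..<d}\<close>.  An element is represented by its coordinate function with respect to
  this basis; \<open>pick S i\<close> is the element \<open>s\<^sub>i\<close>.  The \<open>S\<close>-coordinate of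
  \<open>v\<^sub>0 \<and> \<dots> \<and> v\<^bsub>k-1\<^esub>\<close> is the minor of the \<open>d \<times> k\<close> matrix with columns \<open>v\<^sub>j\<close>
  on the rows in \<open>S\<close>.
\<close>

definition ksets :: "nat \<Rightarrow> nat \<Rightarrow> nat set set" where
  "ksets d k = {S. S \<subseteq> {0..<d} \<and> card S = k}"

definition ext_power :: "nat \<Rightarrow> nat \<Rightarrow> (nat set \<Rightarrow> 'a::field) set" where
  "ext_power d k = {x. \<forall>S. S \<notin> ksets d k \<longrightarrow> x S = 0}"

definition ext_scale :: "'a::field \<Rightarrow> (nat set \<Rightarrow> 'a) \<Rightarrow> nat set \<Rightarrow> 'a" where
  "ext_scale c x = (\<lambda>S. c * x S)"

definition wedge :: "nat \<Rightarrow> nat \<Rightarrow> (nat \<Rightarrow> 'a vec) \<Rightarrow> nat set \<Rightarrow> 'a::field" where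
  "wedge d k v = (\<lambda>S. if S \<in> ksets d k then det (mat k k (\<lambda>(i, j). v j $ pick S i)) else 0)"

text \<open>
  The endomorphism of the exterior power induced by a matrix \<open>A\<close>: the linear extension of
  \<open>e\<^sub>S \<mapsto> A e\<^bsub>s\<^sub>0\<^esub> \<and> \<dots> \<and> A e\<^bsub>s\<^bsub>k-1\<^esub>\<^esub>\<close>.  Lemma \<open>ext_map_wedge\<close> below gives its action on
  arbitrary decomposable elements.
\<close>

definition ext_map :: "nat \<Rightarrow> nat \<Rightarrow> 'a mat \<Rightarrow> (nat set \<Rightarrow> 'a) \<Rightarrow> nat set \<Rightarrow> 'a::field" where
  "ext_map d k A x = (\<Sum>S\<in>ksets d k. ext_scale (x S) (wedge d k (\<lambda>j. A *\<^sub>v unit_vec d (pick S j))))"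

lemma vector_space_ext_scale: "vector_space (ext_scale :: 'a::field \<Rightarrow> _)"
  by unfold_locales (auto simp: ext_scale_def fun_eq_iff algebra_simps)

lemma finite_ksets [simp]: "finite (ksets d k)"
  by (rule finite_subset[of _ "Pow {0..<d}"]) (auto simp: ksets_def)

lemma card_ksets: "card (ksets d k) = d choose k"
  using n_subsets[of "{0..<d}" k] by (simp add: ksets_def)

lemma ksets_pick_less:
  assumes "S \<in> ksets d k" "i < k"
  shows "pick S i < d"
  using pick_in_set_le[of i S] assms by (auto simp: ksets_def)

lemma ksets_pick_image:
  assumes "S \<in> ksets d k"
  shows "inj_on (pick S) {0..<k}" "pick S ` {0..<k} = S"
proof -
  have S: "finite S" "card S = k"
    using assms by (auto simp: ksets_def intro: finite_subset)
  show inj: "inj_on (pick S) {0..<k}"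
    using pick_mono_le[of _ S] S
    by (intro inj_onI) (metis S(2) atLeastLessThan_iff less_irrefl nat_neq_iff)
  have "pick S ` {0..<k} \<subseteq> S"
    using pick_in_set_le[of _ S] S by auto
  moreover have "card (pick S ` {0..<k}) = card S"
    using card_image[OF inj] S by simp
  ultimately show "pick S ` {0..<k} = S"
    using card_subset_eq[OF S(1)] by blast
qed

lemma wedge_in_ext_power: "wedge d k v \<in> ext_power d k"
  by (simp add: wedge_def ext_power_def)

lemma sum_fun_apply: "(\<Sum>i\<in>I. f i) x = (\<Sum>i\<in>I. f i x)"
  by (induction I rule: infinite_finite_induct) auto

lemma wedge_unit_vecs:
  assumes S: "S \<in> ksets d k"
  shows "wedge d k (\<lambda>j. unit_vec d (pick S j)) = (\<lambda>T. if T = S then 1 else (0 :: 'a::field))"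
proof
  fix T
  show "wedge d k (\<lambda>j. unit_vec d (pick S j)) T = (if T = S then 1 else (0 :: 'a))"
  proof (cases "T \<in> ksets d k")
    case False
    then show ?thesis using S by (auto simp: wedge_def)
  next
    case T: True
    define M where "M = mat k k (\<lambda>(i, j). (unit_vec d (pick S j) :: 'a vec) $ pick T i)"
    have M: "M \<in> carrier_mat k k" by (simp add: M_def)
    have ent: "M $$ (i, j) = (if pick T i = pick S j then 1 else 0)" if "i < k" "j < k" for i j
      using that ksets_pick_less[OF T that(1)] ksets_pick_less[OF S that(2)]
      by (auto simp: M_def unit_vec_def)
    have "det M = (if T = S then 1 else 0)"
    proof (cases "T = S")
      case True
      have "M = 1\<^sub>m k"
        using ent inj_on_eq_iff[OF ksets_pick_image(1)[OF S]]
        by (intro eq_matI) (auto simp: True M_def[symmetric] carrier_matD[OF M])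
      then show ?thesis using True by simp
    next
      case False
      have "\<not> T \<subseteq> S"
        using False S T card_subset_eq[of S T] by (auto simp: ksets_def finite_subset)
      then obtain i where i: "i < k" "pick T i \<notin> S"
        by (metis ksets_pick_image(2)[OF T] atLeastLessThan_iff imageE subsetI)
      have "M $$ (i, j) = 0" if "j < k" for j
        using ent[OF i(1) that] i ksets_pick_image(2)[OF S] that by auto
      then have "(\<Prod>l = 0..<k. M $$ (l, p l)) = 0" if "p permutes {0..<k}" for p
        using i(1) permutes_in_image[OF that, of i] by (intro prod_zero bexI[of _ i]) auto
      then have "det M = 0"
        unfolding det_def'[OF M] by (intro sum.neutral) simp
      then show ?thesis using False by simp
    qed
    then show ?thesis using T by (simp add: wedge_def M_def)
  qed
qed

lemma ext_map_wedge:
  fixes A :: "'a::field mat"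
  assumes A: "A \<in> carrier_mat d d" and v: "\<And>j. j < k \<Longrightarrow> v j \<in> carrier_vec d"
  shows "ext_map d k A (wedge d k v) = wedge d k (\<lambda>j. A *\<^sub>v v j)"
proof
  fix T
  show "ext_map d k A (wedge d k v) T = wedge d k (\<lambda>j. A *\<^sub>v v j) T"
  proof (cases "T \<in> ksets d k")
    case False
    then show ?thesis
      by (simp add: ext_map_def sum_fun_apply ext_scale_def wedge_def)
  next
    case T: True
    define a where "a l = vec k (\<lambda>i. A $$ (pick T i, l))" for l
    define F where "F = {f. (\<forall>i\<in>{0..<k}. f i \<in> {0..<d}) \<and> (\<forall>i. i \<notin> {0..<k} \<longrightarrow> f i = i)}"
    define I where "I = {f \<in> F. inj_on f {0..<k}}"
    define t where "t f = (\<Prod>j = 0..<k. v j $ f j) * det (mat\<^sub>r k k (\<lambda>j. a (f j)))" for f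
    have a: "a l \<in> carrier_vec k" for l by (simp add: a_def)
    have pT: "pick T i < d" if "i < k" for i by (rule ksets_pick_less[OF T that])
    have finF: "finite F" unfolding F_def by (rule finite_bounded_functions) auto
    have mr: "mat\<^sub>r k k f \<in> carrier_mat k k" for f :: "nat \<Rightarrow> 'a vec" by simp
    have tr: "mat k k (\<lambda>(i, j). w j $ i) = transpose_mat (mat\<^sub>r k k w)"
      if "\<And>j. j < k \<Longrightarrow> w j \<in> carrier_vec k" for w :: "nat \<Rightarrow> 'a vec"
      using that by (intro eq_matI) auto
    have dettr: "det (mat k k (\<lambda>(i, j). w i j)) = det (mat\<^sub>r k k (\<lambda>j. vec k (\<lambda>i. w i j)))"
      for w :: "nat \<Rightarrow> nat \<Rightarrow> 'a"
    proof -
      have "mat k k (\<lambda>(i, j). w i j) = transpose_mat (mat\<^sub>r k k (\<lambda>j. vec k (\<lambda>i. w i j)))"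
        by (intro eq_matI) auto
      then show ?thesis using det_transpose[OF mr] by simp
    qed
    have "wedge d k (\<lambda>j. A *\<^sub>v v j) T
        = det (mat\<^sub>r k k (\<lambda>j. vec k (\<lambda>i. (A *\<^sub>v v j) $ pick T i)))"
      using T dettr[of "\<lambda>i j. (A *\<^sub>v v j) $ pick T i"] by (simp add: wedge_def)
    also have "mat\<^sub>r k k (\<lambda>j. vec k (\<lambda>i. (A *\<^sub>v v j) $ pick T i))
        = mat\<^sub>r k k (\<lambda>j. finsum_vec TYPE('a) k (\<lambda>l. (v j $ l) \<cdot>\<^sub>v a l) {0..<d})"
    proof (intro eq_matI)
      fix j i assume "j < dim_row (mat\<^sub>r k k (\<lambda>j. finsum_vec TYPE('a) k (\<lambda>l. (v j $ l) \<cdot>\<^sub>v a l) {0..<d}))"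
        "i < dim_col (mat\<^sub>r k k (\<lambda>j. finsum_vec TYPE('a) k (\<lambda>l. (v j $ l) \<cdot>\<^sub>v a l) {0..<d}))"
      then have ji: "j < k" "i < k" by auto
      have "(A *\<^sub>v v j) $ pick T i = (\<Sum>l = 0..<d. v j $ l * A $$ (pick T i, l))"
        using A v[OF ji(1)] pT[OF ji(2)]
        by (auto simp: scalar_prod_def mult.commute intro!: sum.cong)
      also have "\<dots> = finsum_vec TYPE('a) k (\<lambda>l. (v j $ l) \<cdot>\<^sub>v a l) {0..<d} $ i"
        using ji by (subst index_finsum_vec) (auto simp: a_def)
      finally show "mat\<^sub>r k k (\<lambda>j. vec k (\<lambda>i. (A *\<^sub>v v j) $ pick T i)) $$ (j, i)
        = mat\<^sub>r k k (\<lambda>j. finsum_vec TYPE('a) k (\<lambda>l. (v j $ l) \<cdot>\<^sub>v a l) {0..<d}) $$ (j, i)"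
        using ji finsum_vec_closed[of "\<lambda>l. (v j $ l) \<cdot>\<^sub>v a l" "{0..<d}" k] a by auto
    qed auto
    also have "det \<dots> = (\<Sum>f\<in>F. det (mat\<^sub>r k k (\<lambda>j. (v j $ f j) \<cdot>\<^sub>v a (f j))))"
      unfolding F_def by (rule det_linear_rows_sum) (auto simp: a_def)
    also have "\<dots> = (\<Sum>f\<in>F. t f)"
      unfolding t_def using a by (intro sum.cong refl det_rows_mul) auto
    also have "\<dots> = (\<Sum>f\<in>I. t f)"
    proof (rule sum.mono_neutral_right[OF finF])
      show "I \<subseteq> F" by (auto simp: I_def)
      show "\<forall>f\<in>F - I. t f = 0"
      proof
        fix f assume "f \<in> F - I"
        then obtain i j where ij: "i \<noteq> j" "i < k" "j < k" "f i = f j"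
          by (auto simp: I_def inj_on_def)
        have "det (mat\<^sub>r k k (\<lambda>j. a (f j))) = 0"
          using ij a by (intro det_identical_rows[OF mr ij(1-3)]) auto
        then show "t f = 0" by (simp add: t_def)
      qed
    qed
    also have "\<dots> = (\<Sum>S\<in>ksets d k. \<Sum>f | f \<in> I \<and> f ` {0..<k} = S. t f)"
    proof (rule sum.group[symmetric])
      show "finite I" using finF by (simp add: I_def)
      show "(\<lambda>f. f ` {0..<k}) ` I \<subseteq> ksets d k"
        by (auto simp: I_def F_def ksets_def card_image)
    qed simp
    also have "\<dots> = (\<Sum>S\<in>ksets d k. wedge d k v S * wedge d k (\<lambda>j. A *\<^sub>v unit_vec d (pick S j)) T)"
    proof (rule sum.cong[OF refl])
      fix S assume S: "S \<in> ksets d k"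
      define b where "b = mat\<^sub>r k k (\<lambda>j. a (pick S j))"
      have b: "b \<in> carrier_mat k k" by (simp add: b_def)
      note inj = ksets_pick_image(1)[OF S] and img = ksets_pick_image(2)[OF S]
      let ?g = "\<lambda>p i. if i < k then pick S (p i) else i"
      let ?h = "\<lambda>f i. if i < k then the_inv_into {0..<k} (pick S) (f i) else i"
      have "(\<Sum>f | f \<in> I \<and> f ` {0..<k} = S. t f)
          = (\<Sum>p | p permutes {0..<k}. signof p * (\<Prod>j = 0..<k. v j $ pick S (p j)) * det b)"
      proof (rule sum.reindex_bij_witness[of _ ?g ?h])
        fix f assume f: "f \<in> {f \<in> I. f ` {0..<k} = S}"
        then have fS: "f i \<in> pick S ` {0..<k}" if "i < k" for i using that img by auto
        have pf: "pick S (the_inv_into {0..<k} (pick S) (f i)) = f i" if "i < k" for i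
          by (rule f_the_inv_into_f[OF inj fS[OF that]])
        have lt: "the_inv_into {0..<k} (pick S) (f i) < k" if "i < k" for i
          using the_inv_into_into[OF inj fS[OF that], of "{0..<k}"] by simp
        show "?g (?h f) = f"
          using f pf lt by (auto simp: fun_eq_iff I_def F_def)
        have "inj_on f {0..<k}" using f by (simp add: I_def)
        then have "inj_on (?h f) {0..<k}"
          using pf unfolding inj_on_def by (metis atLeastLessThan_iff)
        then have hp: "?h f permutes {0..<k}"
          using lt by (intro inj_on_nat_permutes) auto
        then show "?h f \<in> {p. p permutes {0..<k}}" by simp
        have "mat\<^sub>r k k (\<lambda>j. a (f j)) = mat k k (\<lambda>(i, j). b $$ (?h f i, j))"
          using pf lt a by (intro eq_matI) (auto simp: b_def)
        then have "det (mat\<^sub>r k k (\<lambda>j. a (f j))) = signof (?h f) * det b"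
          using det_permute_rows[OF b hp] by simp
        moreover have "(\<Prod>j = 0..<k. v j $ pick S (?h f j)) = (\<Prod>j = 0..<k. v j $ f j)"
          using pf by (intro prod.cong) auto
        ultimately show "signof (?h f) * (\<Prod>j = 0..<k. v j $ pick S (?h f j)) * det b = t f"
          by (simp add: t_def ac_simps)
      next
        fix p assume "p \<in> {p. p permutes {0..<k}}"
        then have p: "p permutes {0..<k}" by simp
        have lt: "p i < k" if "i < k" for i using permutes_in_image[OF p, of i] that by simp
        show "?h (?g p) = p"
          using p lt the_inv_into_f_f[OF inj] by (auto simp: fun_eq_iff permutes_def)
        have im: "?g p ` {0..<k} = S"
        proof -
          have "?g p ` {0..<k} = pick S ` (p ` {0..<k})" by (auto simp: image_iff)
          then show ?thesis using permutes_image[OF p] img by simp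
        qed
        have "inj_on (pick S \<circ> p) {0..<k}"
          using inj permutes_inj_on[OF p] permutes_image[OF p] by (intro comp_inj_on) auto
        then have "inj_on (?g p) {0..<k}"
          by (rule inj_on_cong[THEN iffD1, rotated]) auto
        moreover have "?g p \<in> F"
          unfolding F_def using lt ksets_pick_less[OF S] by simp
        ultimately have "?g p \<in> I" by (simp add: I_def)
        then show "?g p \<in> {f \<in> I. f ` {0..<k} = S}"
          using im by blast
      qed
      also have "\<dots> = det (mat\<^sub>r k k (\<lambda>j. vec k (\<lambda>i. v j $ pick S i))) * det b"
      proof -
        have "p j < k" if "p permutes {0..<k}" "j < k" for p j
          using permutes_in_image[OF that(1), of j] that(2) by simp
        then show ?thesis
          unfolding det_def'[OF mr] sum_distrib_right
          by (intro sum.cong refl arg_cong2[where f = times] prod.cong) auto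
      qed
      also have "det (mat\<^sub>r k k (\<lambda>j. vec k (\<lambda>i. v j $ pick S i))) = wedge d k v S"
        using S dettr[of "\<lambda>i j. v j $ pick S i"] by (simp add: wedge_def)
      also have "b = mat\<^sub>r k k (\<lambda>j. vec k (\<lambda>i. (A *\<^sub>v unit_vec d (pick S j)) $ pick T i))"
        using A pT ksets_pick_less[OF S] by (intro eq_matI) (auto simp: b_def a_def)
      also have "det \<dots> = wedge d k (\<lambda>j. A *\<^sub>v unit_vec d (pick S j)) T"
        using T dettr[of "\<lambda>i j. (A *\<^sub>v unit_vec d (pick S j)) $ pick T i"] by (simp add: wedge_def)
      finally show "(\<Sum>f | f \<in> I \<and> f ` {0..<k} = S. t f)
        = wedge d k v S * wedge d k (\<lambda>j. A *\<^sub>v unit_vec d (pick S j)) T" .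
    qed
    also have "\<dots> = ext_map d k A (wedge d k v) T"
      by (simp add: ext_map_def sum_fun_apply ext_scale_def)
    finally show ?thesis by simp
  qed
qed


section \<open>Gain graphs\<close>

text \<open>
  Walks ignore the orientation of the edges: the step \<open>(e, True)\<close> traverses \<open>e\<close> from its tail
  to its head and contributes the gain \<open>\<psi> e\<close>, the step \<open>(e, False)\<close> traverses \<open>e\<close> backwards and
  contributes the inverse.
\<close>

fun gain_walk :: "('v, 'e) pre_digraph \<Rightarrow> 'e set \<Rightarrow> 'v \<Rightarrow> ('e \<times> bool) list \<Rightarrow> 'v \<Rightarrow> bool" where
  "gain_walk G F u [] v \<longleftrightarrow> u = v"
| "gain_walk G F u ((e, fwd) # ws) v \<longleftrightarrow> e \<in> F \<and>
     (if fwd then tail G e = u \<and> gain_walk G F (head G e) ws v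
      else head G e = u \<and> gain_walk G F (tail G e) ws v)"

fun walk_gain :: "('g, 'c) monoid_scheme \<Rightarrow> ('e \<Rightarrow> 'g) \<Rightarrow> ('e \<times> bool) list \<Rightarrow> 'g" where
  "walk_gain \<Gamma> \<psi> [] = \<one>\<^bsub>\<Gamma>\<^esub>"
| "walk_gain \<Gamma> \<psi> ((e, fwd) # ws) = (if fwd then \<psi> e else inv\<^bsub>\<Gamma>\<^esub> \<psi> e) \<otimes>\<^bsub>\<Gamma>\<^esub> walk_gain \<Gamma> \<psi> ws"

definition edge_verts :: "('v, 'e) pre_digraph \<Rightarrow> 'e set \<Rightarrow> 'v set" where
  "edge_verts G F = tail G ` F \<union> head G ` F"

definition edge_comps :: "('v, 'e) pre_digraph \<Rightarrow> 'e set \<Rightarrow> 'e set set" where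
  "edge_comps G F = (\<lambda>e. {f \<in> F. \<exists>ws. gain_walk G F (tail G e) ws (tail G f)}) ` F"

text \<open>
  For connected \<open>X\<close> another choice of the base vertex replaces the subgroup by a conjugate one,
  which does not affect \<open>d_rep\<close> below.
\<close>

definition gain_subgroup ::
  "('g, 'c) monoid_scheme \<Rightarrow> ('v, 'e) pre_digraph \<Rightarrow> ('e \<Rightarrow> 'g) \<Rightarrow> 'e set \<Rightarrow> 'g set" where
  "gain_subgroup \<Gamma> G \<psi> X =
    (let u = (SOME u. u \<in> edge_verts G X) in {walk_gain \<Gamma> \<psi> ws | ws. gain_walk G X u ws u})"


section \<open>The count function\<close>

abbreviation GL :: "'a::field itself \<Rightarrow> nat \<Rightarrow> 'a mat monoid" where
  "GL F d \<equiv> units_of (ring_mat F d ())"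

definition d_rep :: "nat \<Rightarrow> nat \<Rightarrow> ('g \<Rightarrow> 'a::field mat) \<Rightarrow> 'g set \<Rightarrow> nat" where
  "d_rep d k \<rho> Y =
    vector_space.dim ext_scale (module.span ext_scale
      (\<Union>\<gamma>\<in>Y. (\<lambda>x. ext_map d k (\<rho> \<gamma>) x - x) ` ext_power d k))"

definition f_rep :: "('g, 'c) monoid_scheme \<Rightarrow> nat \<Rightarrow> nat \<Rightarrow> ('g \<Rightarrow> 'a::field mat)
    \<Rightarrow> ('v, 'e) pre_digraph \<Rightarrow> ('e \<Rightarrow> 'g) \<Rightarrow> 'e set \<Rightarrow> int" where
  "f_rep \<Gamma> d k \<rho> G \<psi> F =
    int (d choose k) * int (card (edge_verts G F)) - int (d choose k) * int (card (edge_comps G F))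
      + (\<Sum>X\<in>edge_comps G F. int (d_rep d k \<rho> (gain_subgroup \<Gamma> G \<psi> X)))"


section \<open>The extension field and the vectors attached to the edges\<close>

text \<open>
  The field extension is given by an embedding \<open>h\<close>.  A polynomial with coefficients in the
  smaller field whose indeterminates are indexed by the elements of the larger one is a
  finitely supported function on monomials; \<open>poly_eval\<close> substitutes each element for its own
  indeterminate.
\<close>

definition poly_eval :: "('f::field \<Rightarrow> 'k::field) \<Rightarrow> (('k \<Rightarrow>\<^sub>0 nat) \<Rightarrow>\<^sub>0 'f) \<Rightarrow> 'k" where
  "poly_eval h P =
    (\<Sum>m\<in>Poly_Mapping.keys P. h (Poly_Mapping.lookup P m) *
      (\<Prod>a\<in>Poly_Mapping.keys m. a ^ Poly_Mapping.lookup m a))"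

definition alg_indep :: "('f::field \<Rightarrow> 'k::field) \<Rightarrow> 'k set \<Rightarrow> bool" where
  "alg_indep h A \<longleftrightarrow>
    (\<forall>P. (\<forall>m\<in>Poly_Mapping.keys P. Poly_Mapping.keys m \<subseteq> A) \<longrightarrow> poly_eval h P = 0 \<longrightarrow> P = 0)"

text \<open>
  \<open>p e i\<close> for \<open>i < k\<close> are the vectors attached to the edge \<open>e\<close> (indices are shifted to start
  at \<open>0\<close>).
\<close>

definition xhat :: "nat \<Rightarrow> nat \<Rightarrow> ('f::field \<Rightarrow> 'k::field) \<Rightarrow> ('g \<Rightarrow> 'f mat) \<Rightarrow> ('v, 'e) pre_digraph
    \<Rightarrow> ('e \<Rightarrow> 'g) \<Rightarrow> ('e \<Rightarrow> nat \<Rightarrow> 'k vec) \<Rightarrow> 'e \<Rightarrow> 'v \<Rightarrow> nat set \<Rightarrow> 'k" where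
  "xhat d k h \<rho> G \<psi> p e v =
    (let w = wedge d k (p e);
         w' = wedge d k (\<lambda>i. map_mat h (\<rho> (\<psi> e)) *\<^sub>v p e i)
     in if tail G e = head G e then (if v = tail G e then w' - w else 0)
        else if v = tail G e then - w'
        else if v = head G e then w
        else 0)"

definition lin_indep_family :: "('i \<Rightarrow> 'v \<Rightarrow> nat set \<Rightarrow> 'k::field) \<Rightarrow> 'i set \<Rightarrow> bool" where
  "lin_indep_family x F \<longleftrightarrow>
    (\<forall>c. (\<Sum>e\<in>F. (\<lambda>v. ext_scale (c e) (x e v))) = 0 \<longrightarrow> (\<forall>e\<in>F. c e = 0))"

end

theory Submission
  imports Defs
begin

text \<open>
  For an edge \<open>e\<close> let \<open>A\<^sub>e\<close> be the space of all vectors with entries \<open>-\<rho>(\<psi>\<^sub>e) w\<close> at the tail and \<open>w\<close>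
  at the head of \<open>e\<close>, where \<open>w\<close> ranges over the exterior power; it is spanned by the \<open>A\<^sub>e\<close>-vectors of
  the basis elements \<open>w = e\<^sub>S\<close>.  Switching along walks from a root of each component shows that
  \<open>f\<close> is the rank function \<open>X \<mapsto> dim (\<Sum>\<^bsub>e \<in> X\<^esub> A\<^sub>e)\<close>.

  Each \<open>x\<^sub>e\<close> lies in the scalar extension of \<open>A\<^sub>e\<close>, so independence of \<open>F\<close> forces \<open>|X| \<le> f X\<close> for all
  \<open>X \<subseteq> F\<close>.  Conversely, if the count holds, Rado's theorem selects sets \<open>S\<^sub>e\<close> such that the vectors
  belonging to \<open>w = e\<^bsub>S\<^sub>e\<^esub>\<close> are independent over the small field.  These arise from \<open>x\<^sub>e\<close> by specialising
  the \<open>p\<^bsub>e,i\<^esub>\<close> to unit vectors.  Hence a polynomial determinant is nonzero, and it stays nonzero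
  when the coordinates of the \<open>p\<^bsub>e,i\<^esub>\<close> are algebraically independent.
\<close>

section \<open>Rado's theorem for vector spaces\<close>

context vector_space
begin

lemma dim_mono_finite:
  assumes "finite W" "V \<subseteq> span W"
  shows "dim V \<le> dim W"
proof -
  obtain B where B: "B \<subseteq> W" "independent B" "W \<subseteq> span B" "card B = dim W"
    using basis_exists by blast
  have "V \<subseteq> span B"
    using assms(2) span_minimal[OF B(3) subspace_span] by blast
  then show ?thesis
    using dim_le_card[of V B] finite_subset[OF B(1) assms(1)] B(4) by simp
qed

text \<open>The intersection is that of the generating sets, not of their spans, so this is
  submodularity of matroid rank. Extend a basis \<open>B\<close> of the intersection to a basis
  \<open>C\<close> of \<open>X\<close>, then to a basis \<open>D\<close> of the union. The new
  elements \<open>D - C\<close> lie in \<open>Y\<close>, so together with \<open>B\<close> they form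
  an independent subset of \<open>Y\<close>.\<close>

lemma dim_submodular:
  assumes "finite X" "finite Y"
  shows "dim (X \<union> Y) + dim (X \<inter> Y) \<le> dim X + dim Y"
proof -
  obtain B where B: "B \<subseteq> X \<inter> Y" "independent B" "X \<inter> Y \<subseteq> span B" "card B = dim (X \<inter> Y)"
    using basis_exists by blast
  obtain C where C: "B \<subseteq> C" "C \<subseteq> X" "independent C" "X \<subseteq> span C"
    using maximal_independent_subset_extend[of B X] B by blast
  obtain D where D: "C \<subseteq> D" "D \<subseteq> X \<union> Y" "independent D" "X \<union> Y \<subseteq> span D"
    using maximal_independent_subset_extend[of C "X \<union> Y"] C by blast
  have fin: "finite B" "finite C" "finite D"
    using assms B(1) C(2) D(2) by (auto intro: finite_subset)
  have dC: "card C = dim X" and dD: "card D = dim (X \<union> Y)"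
    using basis_card_eq_dim C(2-4) D(2-4) by auto
  have "(D - C) \<union> B \<subseteq> Y"
  proof -
    have "x \<in> Y" if x: "x \<in> D - C" for x
    proof (rule ccontr)
      assume "x \<notin> Y"
      then have "x \<in> span C" using x D(2) C(4) by blast
      then have "x \<in> span (D - {x})"
        using span_mono[of C "D - {x}"] D(1) x by blast
      then show False using D(3) x by (auto simp: dependent_def)
    qed
    then show ?thesis using B(1) by blast
  qed
  moreover have "independent ((D - C) \<union> B)"
    using D(3) by (rule independent_mono) (use C(1) D(1) in blast)
  ultimately have "card ((D - C) \<union> B) \<le> dim Y"
    using dim_mono_finite[OF assms(2), of "(D - C) \<union> B"] span_superset[of Y]
      dim_eq_card_independent by fastforce
  moreover have "card ((D - C) \<union> B) = card D - card C + card B"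
    using C(1) fin D(1) by (subst card_Un_disjoint) (auto simp: card_Diff_subset)
  moreover have "card C \<le> card D" using D(1) fin by (simp add: card_mono)
  ultimately show ?thesis using B(4) dC dD by linarith
qed

text \<open>Induction on the total size of the sets \<open>A i\<close>. If all are singletons, the
  rank condition for \<open>I\<close> itself makes the only transversal injective and independent.
  Otherwise some \<open>A i\<close> has two elements, and one of them can be deleted without
  violating the rank condition.\<close>

theorem rado_independent_transversal:
  assumes "finite I" "\<And>i. i \<in> I \<Longrightarrow> finite (A i)"
    and "\<And>J. J \<subseteq> I \<Longrightarrow> card J \<le> dim (\<Union>i\<in>J. A i)"
  shows "\<exists>x. (\<forall>i\<in>I. x i \<in> A i) \<and> inj_on x I \<and> independent (x ` I)"
  using assms(2-)
proof (induction "\<Sum>i\<in>I. card (A i)" arbitrary: A rule: less_induct)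
  case less
  note finA = less.prems(1) and rank = less.prems(2)
  have finU: "finite (\<Union>i\<in>J. A i)" if "J \<subseteq> I" for J
    using that finA assms(1) by (auto intro: finite_subset)
  have ne: "A i \<noteq> {}" if "i \<in> I" for i
    using rank[of "{i}"] that dim_eq_card_independent[OF independent_empty] by auto
  show ?case
  proof (cases "\<forall>i\<in>I. \<exists>a. A i = {a}")
    case True
    then obtain x where x: "\<And>i. i \<in> I \<Longrightarrow> A i = {x i}" by metis
    have im: "(\<Union>i\<in>I. A i) = x ` I" using x by auto
    have fin: "finite (x ` I)" using assms(1) by simp
    obtain B where B: "B \<subseteq> x ` I" "independent B" "card B = dim (x ` I)"
      by (rule basis_exists[of "x ` I"])
    have "card I \<le> card B" using rank[of I] im B(3) by simp
    moreover have "card B \<le> card (x ` I)" using B(1) fin by (simp add: card_mono)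
    moreover have "card (x ` I) \<le> card I" using assms(1) by (rule card_image_le)
    ultimately have "card (x ` I) = card I" "B = x ` I"
      using B(1) fin card_subset_eq[of "x ` I" B] by auto
    then show ?thesis
      using B(2) x assms(1) by (intro exI[of _ x]) (auto simp: inj_on_iff_eq_card)
  next
    case False
    then obtain i where i: "i \<in> I" "\<nexists>a. A i = {a}" by auto
    obtain a b where ab: "a \<in> A i" "b \<in> A i" "a \<noteq> b"
      using ne[OF i(1)] i(2) by blast
    \<comment> \<open>Deleting \<open>c\<close> affects only index sets containing \<open>i\<close>;
      \<open>ok\<close> is the rank condition for these, written as \<open>J\<close> together with
      \<open>i\<close>.\<close>
    have step: ?thesis
      if c: "c \<in> A i"
        and ok: "\<And>J. J \<subseteq> I - {i} \<Longrightarrow> card J + 1 \<le> dim ((A i - {c}) \<union> (\<Union>j\<in>J. A j))" for c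
    proof -
      let ?A = "A(i := A i - {c})"
      have "(\<Sum>j\<in>I. card (?A j)) < (\<Sum>j\<in>I. card (A j))"
        using assms(1) i(1) c finA card_Diff1_less[of "A i" c]
        by (intro sum_strict_mono_ex1 ballI bexI[of _ i]) (auto simp: card_Diff1_le intro: card_Diff1_less)
      moreover have "finite (?A j)" if "j \<in> I" for j using finA that by auto
      moreover have "card J \<le> dim (\<Union>j\<in>J. ?A j)" if J: "J \<subseteq> I" for J
      proof (cases "i \<in> J")
        case True
        have eq: "(\<Union>j\<in>J. ?A j) = (A i - {c}) \<union> (\<Union>j\<in>J - {i}. A j)"
          using True by auto
        have card: "card J = card (J - {i}) + 1"
          using True J assms(1) by (metis Suc_eq_plus1 card_Suc_Diff1 finite_subset)
        have "J - {i} \<subseteq> I - {i}" using J by blast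
        then show ?thesis unfolding eq card by (rule ok)
      next
        case False
        then have "(\<Union>j\<in>J. ?A j) = (\<Union>j\<in>J. A j)" by auto
        then show ?thesis using rank[OF J] by simp
      qed
      ultimately obtain x where "\<forall>j\<in>I. x j \<in> ?A j" "inj_on x I" "independent (x ` I)"
        using less.hyps[of ?A] by blast
      then show ?thesis by (intro exI[of _ x]) (auto split: if_splits)
    qed
    \<comment> \<open>By submodularity, deleting \<open>a\<close> and deleting \<open>b\<close> from \<open>A i\<close> cannot both break the rank condition.\<close>
    have "(\<forall>J. J \<subseteq> I - {i} \<longrightarrow> card J + 1 \<le> dim ((A i - {a}) \<union> (\<Union>j\<in>J. A j))) \<or>
        (\<forall>J. J \<subseteq> I - {i} \<longrightarrow> card J + 1 \<le> dim ((A i - {b}) \<union> (\<Union>j\<in>J. A j)))"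
    proof (rule ccontr)
      assume "\<not> ?thesis"
      then obtain J L where J: "J \<subseteq> I - {i}" "dim ((A i - {a}) \<union> (\<Union>j\<in>J. A j)) \<le> card J"
        and L: "L \<subseteq> I - {i}" "dim ((A i - {b}) \<union> (\<Union>j\<in>L. A j)) \<le> card L"
        by (auto simp: not_le less_Suc_eq_le)
      let ?X = "(A i - {a}) \<union> (\<Union>j\<in>J. A j)" and ?Y = "(A i - {b}) \<union> (\<Union>j\<in>L. A j)"
      have fin: "finite ?X" "finite ?Y"
        using finA i(1) finU[of J] finU[of L] J(1) L(1) by auto
      \<comment> \<open>As \<open>a\<close> and \<open>b\<close> differ, the union recovers all of
        \<open>A i\<close> and has rank at least \<open>card (J \<union> L) + 1\<close>, while the
        intersection contains every \<open>A j\<close> with \<open>j\<close> in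
        \<open>J \<inter> L\<close>. The two ranks add up to more than
        \<open>card J + card L\<close>.\<close>
      have un: "?X \<union> ?Y = (\<Union>j\<in>insert i (J \<union> L). A j)"
        using ab by auto
      have finJL: "finite J" "finite L"
        using J(1) L(1) assms(1) by (auto intro: finite_subset)
      have "card (insert i (J \<union> L)) \<le> dim (?X \<union> ?Y)"
        unfolding un using i(1) J(1) L(1) by (intro rank) auto
      moreover have "card (insert i (J \<union> L)) = card (J \<union> L) + 1"
        using J(1) L(1) finJL by (subst card_insert_disjoint) auto
      moreover have "card (J \<inter> L) \<le> dim (\<Union>j\<in>J \<inter> L. A j)"
        using J(1) by (intro rank) auto
      moreover have "dim (\<Union>j\<in>J \<inter> L. A j) \<le> dim (?X \<inter> ?Y)"
        using fin by (intro dim_mono_finite subset_trans[OF _ span_superset]) auto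
      moreover have "card (J \<union> L) + card (J \<inter> L) = card J + card L"
        using card_Un_Int[OF finJL] by simp
      ultimately show False using dim_submodular[OF fin] J(2) L(2) by linarith
    qed
    then show ?thesis using step[of a] step[of b] ab by blast
  qed
qed

end

section \<open>Linear algebra of families indexed by the vertices\<close>

text \<open>The scaling written out inside \<open>lin_indep_family\<close>, named so that these
  families form a \<open>vector_space\<close>.\<close>

definition fam_scale :: "'a::field \<Rightarrow> ('v \<Rightarrow> nat set \<Rightarrow> 'a) \<Rightarrow> 'v \<Rightarrow> nat set \<Rightarrow> 'a" where
  "fam_scale c x = (\<lambda>v. ext_scale c (x v))"

lemma fam_scale_apply [simp]: "fam_scale c x v S = c * x v S"
  by (simp add: fam_scale_def ext_scale_def)

interpretation ext: vector_space "ext_scale :: 'a::field \<Rightarrow> _"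
  by (rule vector_space_ext_scale)

interpretation fam: vector_space "fam_scale :: 'a::field \<Rightarrow> ('v \<Rightarrow> _) \<Rightarrow> _"
  by unfold_locales (auto simp: fun_eq_iff algebra_simps)

text \<open>A repeated vector makes a family dependent but cannot be seen in its image, hence the
  injectivity condition.\<close>

lemma lin_indep_family_iff:
  fixes x :: "'i \<Rightarrow> 'v \<Rightarrow> nat set \<Rightarrow> 'a::field"
  assumes "finite F"
  shows "lin_indep_family x F \<longleftrightarrow> inj_on x F \<and> fam.independent (x ` F)"
proof
  assume L: "lin_indep_family x F"
  have L': "c e = 0" if "(\<Sum>e\<in>F. fam_scale (c e) (x e)) = 0" "e \<in> F" for c e
    using L that unfolding lin_indep_family_def fam_scale_def by blast
  have inj: "inj_on x F"
  proof (rule inj_onI, rule ccontr)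
    fix a b assume ab: "a \<in> F" "b \<in> F" "x a = x b" "a \<noteq> b"
    define c where "c e = (if e = a then 1 else if e = b then -1 else (0::'a))" for e
    have "(\<Sum>e\<in>F. fam_scale (c e) (x e)) = (\<Sum>e\<in>{a, b}. fam_scale (c e) (x e))"
      using assms ab(1,2) by (intro sum.mono_neutral_right) (auto simp: c_def)
    also have "\<dots> = fam_scale 1 (x a) + fam_scale (- 1) (x b)"
      using ab(4) by (simp add: c_def)
    also have "\<dots> = 0"
      unfolding ab(3) by (simp add: fun_eq_iff)
    finally have "c a = 0" by (rule L'[OF _ ab(1)])
    then show False by (simp add: c_def)
  qed
  moreover have "fam.independent (x ` F)"
    unfolding fam.dependent_finite[OF finite_imageI[OF assms]]
  proof (intro notI, elim exE conjE bexE)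
    fix u y assume u: "(\<Sum>y\<in>x ` F. fam_scale (u y) y) = 0" and y: "y \<in> x ` F" "u y \<noteq> 0"
    have z: "(\<Sum>e\<in>F. fam_scale (u (x e)) (x e)) = 0"
      using u by (simp only: sum.reindex[OF inj] o_def)
    obtain e where e: "e \<in> F" "y = x e" using y(1) by blast
    have "u (x e) = 0" by (rule L'[OF z e(1)])
    then show False using y(2) e(2) by simp
  qed
  ultimately show "inj_on x F \<and> fam.independent (x ` F)" by blast
next
  assume R: "inj_on x F \<and> fam.independent (x ` F)"
  then have inj: "inj_on x F" and ind: "fam.independent (x ` F)" by auto
  show "lin_indep_family x F"
    unfolding lin_indep_family_def
  proof (intro allI impI ballI)
    fix c e assume c: "(\<Sum>e\<in>F. (\<lambda>v. ext_scale (c e) (x e v))) = 0" and e: "e \<in> F"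
    define u where "u = (\<lambda>y. c (the_inv_into F x y))"
    have ux: "u (x e) = c e" if "e \<in> F" for e
      using the_inv_into_f_f[OF inj that] by (simp add: u_def)
    have "(\<Sum>y\<in>x ` F. fam_scale (u y) y) = (\<Sum>e\<in>F. fam_scale (u (x e)) (x e))"
      by (simp only: sum.reindex[OF inj] o_def)
    also have "\<dots> = (\<Sum>e\<in>F. (\<lambda>v. ext_scale (c e) (x e v)))"
      by (intro sum.cong) (simp_all add: ux fam_scale_def)
    also note c
    finally have "u (x e) = 0"
      using fam.independentD[OF ind finite_imageI[OF assms] subset_refl] e by blast
    then show "c e = 0" using ux e by simp
  qed
qed

lemma lin_indep_family_subset:
  assumes "lin_indep_family x F" "X \<subseteq> F" "finite F"
  shows "lin_indep_family x X"
  using assms lin_indep_family_iff[of F x] lin_indep_family_iff[of X x] finite_subset[of X F]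
    fam.independent_mono[of "x ` F" "x ` X"] inj_on_subset[of x F X] by blast

text \<open>Prescribe a functional on the independent family and extend it linearly to the whole
  space. Since all supports lie in the finite set \<open>U\<close>, it is given there by finitely
  many coefficients. These later serve as constant rows of a matrix.\<close>

lemma lin_indep_family_dual:
  fixes x :: "'i \<Rightarrow> 'v \<Rightarrow> nat set \<Rightarrow> 'a::field"
  assumes "finite F" "finite U" and ind: "lin_indep_family x F"
    and supp: "\<And>e v S. e \<in> F \<Longrightarrow> (v, S) \<notin> U \<Longrightarrow> x e v S = 0"
  shows "\<exists>a :: 'i \<Rightarrow> 'v \<times> nat set \<Rightarrow> 'a.
    \<forall>e\<in>F. \<forall>e'\<in>F. (\<Sum>u\<in>U. a e u * x e' (fst u) (snd u)) = (if e' = e then 1 else 0)"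
proof -
  interpret pair: vector_space_pair "fam_scale :: 'a \<Rightarrow> ('v \<Rightarrow> _) \<Rightarrow> _" "(*) :: 'a \<Rightarrow> 'a \<Rightarrow> 'a"
    by unfold_locales (auto simp: algebra_simps)
  have inj: "inj_on x F" and ind: "fam.independent (x ` F)"
    using ind lin_indep_family_iff[OF assms(1)] by blast+
  have "\<exists>a :: 'v \<times> nat set \<Rightarrow> 'a.
      \<forall>e'\<in>F. (\<Sum>u\<in>U. a u * x e' (fst u) (snd u)) = (if e' = e then 1 else 0)" for e
  proof -
    obtain g where lin: "Vector_Spaces.linear fam_scale (*) g"
      and g: "\<forall>y\<in>x ` F. g y = (if the_inv_into F x y = e then 1 else 0)"
      using pair.linear_independent_extend[OF ind, of "\<lambda>y. if the_inv_into F x y = e then 1 else 0"]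
      by (elim exE conjE)
    interpret g: Vector_Spaces.linear "fam_scale :: 'a \<Rightarrow> ('v \<Rightarrow> _) \<Rightarrow> _" "(*) :: 'a \<Rightarrow> 'a \<Rightarrow> 'a" g
      by (rule lin)
    \<comment> \<open>\<open>\<delta> u\<close> is the unit vector at coordinate \<open>u\<close>.
      Families supported on \<open>U\<close> are combinations of these, so the values of
      \<open>g\<close> on them are the coefficients sought.\<close>
    define \<delta> :: "'v \<times> nat set \<Rightarrow> 'v \<Rightarrow> nat set \<Rightarrow> 'a"
      where "\<delta> u = (\<lambda>v S. if (v, S) = u then 1 else 0)" for u
    have "(\<Sum>u\<in>U. g (\<delta> u) * x e' (fst u) (snd u)) = (if e' = e then 1 else 0)" if e': "e' \<in> F" for e'
    proof -
      have "x e' = (\<Sum>u\<in>U. fam_scale (x e' (fst u) (snd u)) (\<delta> u))"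
      proof (intro ext)
        fix v S
        have "(\<Sum>u\<in>U. fam_scale (x e' (fst u) (snd u)) (\<delta> u)) v S
            = (\<Sum>u\<in>U. if (v, S) = u then x e' v S else 0)"
          unfolding sum_fun_apply by (intro sum.cong) (auto simp: \<delta>_def)
        also have "\<dots> = x e' v S"
          using assms(2) supp[OF e'] by simp
        finally show "x e' v S = (\<Sum>u\<in>U. fam_scale (x e' (fst u) (snd u)) (\<delta> u)) v S" ..
      qed
      then have "g (x e') = g (\<Sum>u\<in>U. fam_scale (x e' (fst u) (snd u)) (\<delta> u))"
        by (rule arg_cong)
      also have "\<dots> = (\<Sum>u\<in>U. x e' (fst u) (snd u) * g (\<delta> u))"
        by (simp only: g.sum g.scale)
      finally have "g (x e') = (\<Sum>u\<in>U. x e' (fst u) (snd u) * g (\<delta> u))" .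
      then show ?thesis
        using g e' the_inv_into_f_f[OF inj e'] by (simp add: mult.commute)
    qed
    then show ?thesis by (intro exI[of _ "\<lambda>u. g (\<delta> u)"] ballI)
  qed
  then have "\<forall>e. \<exists>a :: 'v \<times> nat set \<Rightarrow> 'a.
      \<forall>e'\<in>F. (\<Sum>u\<in>U. a u * x e' (fst u) (snd u)) = (if e' = e then 1 else 0)" by (rule allI)
  from choice[OF this] obtain a :: "'i \<Rightarrow> 'v \<times> nat set \<Rightarrow> 'a" where
    "\<forall>e. \<forall>e'\<in>F. (\<Sum>u\<in>U. a e u * x e' (fst u) (snd u)) = (if e' = e then 1 else 0)" ..
  then show ?thesis by (intro exI[of _ a]) simp
qed

section \<open>Generic linear independence\<close>

text \<open>Evaluation at an arbitrary point, so that generic points and specialisations are treated alike.\<close>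

definition mono_eval :: "('x \<Rightarrow> 'b::comm_ring_1) \<Rightarrow> ('x \<Rightarrow>\<^sub>0 nat) \<Rightarrow> 'b" where
  "mono_eval \<theta> m = (\<Prod>a\<in>Poly_Mapping.keys m. \<theta> a ^ Poly_Mapping.lookup m a)"

definition mpoly_eval ::
  "('a::comm_ring_1 \<Rightarrow> 'b::comm_ring_1) \<Rightarrow> ('x \<Rightarrow> 'b) \<Rightarrow> (('x \<Rightarrow>\<^sub>0 nat) \<Rightarrow>\<^sub>0 'a) \<Rightarrow> 'b" where
  "mpoly_eval h \<theta> P = (\<Sum>m\<in>Poly_Mapping.keys P. h (Poly_Mapping.lookup P m) * mono_eval \<theta> m)"

lemma poly_eval_eq_mpoly_eval: "poly_eval h = mpoly_eval h (\<lambda>a. a)"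
  by (simp add: fun_eq_iff poly_eval_def mpoly_eval_def mono_eval_def)

text \<open>Exponents outside the keys are 0, so several monomials can be evaluated over one common
  index set.\<close>

lemma mono_eval_superset:
  assumes "finite X" "Poly_Mapping.keys m \<subseteq> X"
  shows "mono_eval \<theta> m = (\<Prod>a\<in>X. \<theta> a ^ Poly_Mapping.lookup m a)"
  unfolding mono_eval_def using assms
  by (intro prod.mono_neutral_left) (auto simp: in_keys_iff)

lemma mono_eval_add: "mono_eval \<theta> (m + n) = mono_eval \<theta> m * mono_eval \<theta> n"
proof -
  let ?X = "Poly_Mapping.keys m \<union> Poly_Mapping.keys n"
  have "mono_eval \<theta> l = (\<Prod>a\<in>?X. \<theta> a ^ Poly_Mapping.lookup l a)" if "l \<in> {m, n, m + n}" for l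
    using that Poly_Mapping.keys_add[of m n] by (intro mono_eval_superset) auto
  then show ?thesis
    by (simp add: lookup_add power_add prod.distrib)
qed

lemma poly_mapping_sum_singles:
  "P = (\<Sum>m\<in>Poly_Mapping.keys P. Poly_Mapping.single m (Poly_Mapping.lookup P m))"
  by (rule poly_mapping_eqI)
    (auto simp: lookup_sum lookup_single when_def in_keys_iff)

context comm_ring_hom
begin

lemma mpoly_eval_superset:
  assumes "finite X" "Poly_Mapping.keys P \<subseteq> X"
  shows "mpoly_eval hom \<theta> P = (\<Sum>m\<in>X. hom (Poly_Mapping.lookup P m) * mono_eval \<theta> m)"
  unfolding mpoly_eval_def using assms
  by (intro sum.mono_neutral_left) (auto simp: in_keys_iff)

lemma mpoly_eval_add: "mpoly_eval hom \<theta> (P + Q) = mpoly_eval hom \<theta> P + mpoly_eval hom \<theta> Q"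
proof -
  let ?X = "Poly_Mapping.keys P \<union> Poly_Mapping.keys Q"
  have "mpoly_eval hom \<theta> R = (\<Sum>m\<in>?X. hom (Poly_Mapping.lookup R m) * mono_eval \<theta> m)"
    if "R \<in> {P, Q, P + Q}" for R
    using that Poly_Mapping.keys_add[of P Q] by (intro mpoly_eval_superset) auto
  then show ?thesis
    by (simp add: lookup_add hom_add distrib_right sum.distrib)
qed

lemma mpoly_eval_zero: "mpoly_eval hom \<theta> 0 = 0"
  by (simp add: mpoly_eval_def)

lemma mpoly_eval_sum: "mpoly_eval hom \<theta> (\<Sum>i\<in>I. P i) = (\<Sum>i\<in>I. mpoly_eval hom \<theta> (P i))"
  by (induction I rule: infinite_finite_induct) (auto simp: mpoly_eval_zero mpoly_eval_add)

lemma mpoly_eval_single: "mpoly_eval hom \<theta> (Poly_Mapping.single m c) = hom c * mono_eval \<theta> m"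
  by (cases "c = 0") (auto simp: mpoly_eval_def)

lemma mpoly_eval_mult: "mpoly_eval hom \<theta> (P * Q) = mpoly_eval hom \<theta> P * mpoly_eval hom \<theta> Q"
proof -
  let ?s = "\<lambda>P m. Poly_Mapping.single m (Poly_Mapping.lookup P m)"
  have "P * Q = (\<Sum>m\<in>Poly_Mapping.keys P. ?s P m) * (\<Sum>m\<in>Poly_Mapping.keys Q. ?s Q m)"
    using poly_mapping_sum_singles[of P] poly_mapping_sum_singles[of Q] by simp
  also have "mpoly_eval hom \<theta> \<dots> = (\<Sum>m\<in>Poly_Mapping.keys P. \<Sum>n\<in>Poly_Mapping.keys Q.
      (hom (Poly_Mapping.lookup P m) * mono_eval \<theta> m) * (hom (Poly_Mapping.lookup Q n) * mono_eval \<theta> n))"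
    by (simp add: sum_product mult_single mpoly_eval_sum mpoly_eval_single mono_eval_add hom_mult ac_simps)
  finally show ?thesis
    by (simp add: sum_product mpoly_eval_def)
qed

text \<open>As a ring homomorphism, evaluation commutes with determinants; this links the
  specialised, the polynomial and the generic matrices.\<close>

lemma comm_ring_hom_mpoly_eval: "comm_ring_hom (mpoly_eval hom \<theta>)"
proof
  show "mpoly_eval hom \<theta> 1 = 1"
    using mpoly_eval_single[of \<theta> 0 1] by (simp add: mono_eval_def)
qed (auto simp: mpoly_eval_zero mpoly_eval_add mpoly_eval_mult)

end

definition mpoly_var :: "'x \<Rightarrow> ('x \<Rightarrow>\<^sub>0 nat) \<Rightarrow>\<^sub>0 'a::comm_ring_1" where
  "mpoly_var a = Poly_Mapping.single (Poly_Mapping.single a 1) 1"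

definition mpoly_const :: "'a::comm_ring_1 \<Rightarrow> ('x \<Rightarrow>\<^sub>0 nat) \<Rightarrow>\<^sub>0 'a" where
  "mpoly_const c = Poly_Mapping.single 0 c"

lemma (in comm_ring_hom) mpoly_eval_var [simp]: "mpoly_eval hom \<theta> (mpoly_var a) = \<theta> a"
  by (simp add: mpoly_var_def mpoly_eval_single mono_eval_def)

lemma (in comm_ring_hom) mpoly_eval_const [simp]: "mpoly_eval hom \<theta> (mpoly_const c) = hom c"
  by (simp add: mpoly_const_def mpoly_eval_single mono_eval_def)

text \<open>The polynomials that \<open>alg_indep\<close> quantifies over.\<close>

definition mpolys_in :: "'x set \<Rightarrow> (('x \<Rightarrow>\<^sub>0 nat) \<Rightarrow>\<^sub>0 'a::comm_ring_1) set" where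
  "mpolys_in A = {P. \<forall>m\<in>Poly_Mapping.keys P. Poly_Mapping.keys m \<subseteq> A}"

lemma mpolys_in_var: "a \<in> A \<Longrightarrow> mpoly_var a \<in> mpolys_in A"
  by (auto simp: mpolys_in_def mpoly_var_def)

lemma mpolys_in_const: "mpoly_const c \<in> mpolys_in A"
  by (auto simp: mpolys_in_def mpoly_const_def)

lemma mpolys_in_add: "P \<in> mpolys_in A \<Longrightarrow> Q \<in> mpolys_in A \<Longrightarrow> P + Q \<in> mpolys_in A"
  using Poly_Mapping.keys_add[of P Q] unfolding mpolys_in_def by blast

lemma mpolys_in_uminus: "P \<in> mpolys_in A \<Longrightarrow> - P \<in> mpolys_in A"
  by (auto simp: mpolys_in_def in_keys_iff)

lemma mpolys_in_mult: 
  assumes "P \<in> mpolys_in A" "Q \<in> mpolys_in A"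
  shows "P * Q \<in> mpolys_in A"
  unfolding mpolys_in_def
proof (intro CollectI ballI)
  fix m assume "m \<in> Poly_Mapping.keys (P * Q)"
  then obtain a b where ab: "m = a + b" "a \<in> Poly_Mapping.keys P" "b \<in> Poly_Mapping.keys Q"
    using Poly_Mapping.keys_mult[of P Q] by blast
  then show "Poly_Mapping.keys m \<subseteq> A"
    using Poly_Mapping.keys_add[of a b] assms unfolding mpolys_in_def by blast
qed

lemma mpolys_in_sum: "(\<And>i. i \<in> I \<Longrightarrow> P i \<in> mpolys_in A) \<Longrightarrow> (\<Sum>i\<in>I. P i) \<in> mpolys_in A"
  by (induction I rule: infinite_finite_induct) (auto simp: mpolys_in_add, auto simp: mpolys_in_def)

lemma mpolys_in_prod: "(\<And>i. i \<in> I \<Longrightarrow> P i \<in> mpolys_in A) \<Longrightarrow> (\<Prod>i\<in>I. P i) \<in> mpolys_in A"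
  by (induction I rule: infinite_finite_induct) (auto simp: mpolys_in_mult, auto simp: mpolys_in_def)

lemma mpolys_in_det:
  assumes M: "M \<in> carrier_mat n n" and ent: "\<And>i j. i < n \<Longrightarrow> j < n \<Longrightarrow> M $$ (i, j) \<in> mpolys_in A"
  shows "det M \<in> mpolys_in A"
  unfolding det_def'[OF M]
proof (intro mpolys_in_sum)
  fix p assume "p \<in> {p. p permutes {0..<n}}"
  then have "p i < n" if "i < n" for i
    using permutes_in_image[of p "{0..<n}" i] that by simp
  then have P: "(\<Prod>i = 0..<n. M $$ (i, p i)) \<in> mpolys_in A"
    using ent by (intro mpolys_in_prod) auto
  show "signof p * (\<Prod>i = 0..<n. M $$ (i, p i)) \<in> mpolys_in A"
    using P mpolys_in_uminus[OF P] by (auto simp: sign_def)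
qed

text \<open>Independence is an open condition: at \<open>\<sigma>\<close> it is witnessed by a
  square matrix of determinant 1. The corresponding polynomial determinant is therefore nonzero, and
  by algebraic independence its value at the generic point is nonzero as well.\<close>

lemma lin_indep_family_generic:
  fixes h :: "'f::field \<Rightarrow> 'k::field" and Q :: "'i \<Rightarrow> 'v \<Rightarrow> nat set \<Rightarrow> ('k \<Rightarrow>\<^sub>0 nat) \<Rightarrow>\<^sub>0 'f"
  assumes h: "field_hom h" and A: "alg_indep h A" and "finite F" "finite U"
    and Q: "\<And>e v S. e \<in> F \<Longrightarrow> Q e v S \<in> mpolys_in A"
    and supp: "\<And>e v S. e \<in> F \<Longrightarrow> (v, S) \<notin> U \<Longrightarrow> Q e v S = 0"
    and spec: "lin_indep_family (\<lambda>e v S. mpoly_eval id \<sigma> (Q e v S)) F"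
  shows "lin_indep_family (\<lambda>e v S. poly_eval h (Q e v S)) F"
  unfolding lin_indep_family_def
proof (rule allI, rule impI, rule ccontr)
  fix c :: "'i \<Rightarrow> 'k"
  let ?x = "\<lambda>e v S. poly_eval h (Q e v S)"
  assume c: "(\<Sum>e\<in>F. (\<lambda>v. ext_scale (c e) (?x e v))) = 0" and nz: "\<not> (\<forall>e\<in>F. c e = 0)"
  interpret h: field_hom h by (rule h)
  interpret H: comm_ring_hom "poly_eval h :: _ \<Rightarrow> 'k"
    unfolding poly_eval_eq_mpoly_eval by (rule h.comm_ring_hom_mpoly_eval)
  interpret id: comm_ring_hom "id :: 'f \<Rightarrow> 'f" by unfold_locales auto
  interpret S: comm_ring_hom "mpoly_eval id \<sigma> :: _ \<Rightarrow> 'f"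
    by (rule id.comm_ring_hom_mpoly_eval)
  have supp': "mpoly_eval id \<sigma> (Q e v S) = 0" if "e \<in> F" "(v, S) \<notin> U" for e v S
    using supp[OF that] by (simp only: S.hom_zero)
  obtain a :: "'i \<Rightarrow> 'v \<times> nat set \<Rightarrow> 'f" where a: "\<forall>e\<in>F. \<forall>e'\<in>F.
      (\<Sum>u\<in>U. a e u * mpoly_eval id \<sigma> (Q e' (fst u) (snd u))) = (if e' = e then 1 else 0)"
    using lin_indep_family_dual[OF \<open>finite F\<close> \<open>finite U\<close> spec supp'] by blast
  define n where "n = card F"
  obtain en where en: "bij_betw en {0..<n} F"
    using ex_bij_betw_nat_finite[OF \<open>finite F\<close>] n_def by blast
  have enF: "en i \<in> F" if "i < n" for i using en that by (auto simp: bij_betw_def)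
  have en_eq: "en j = en i \<longleftrightarrow> j = i" if "i < n" "j < n" for i j
    using en that by (auto simp: bij_betw_def inj_on_eq_iff)
  \<comment> \<open>The functionals dual to the family at \<open>\<sigma>\<close> are kept as
    constants and applied to the polynomial vectors; specialising at \<open>\<sigma>\<close> returns
    the identity matrix.\<close>
  define M where "M = mat n n (\<lambda>(i, j). \<Sum>u\<in>U. mpoly_const (a (en i) u) * Q (en j) (fst u) (snd u))"
  have M: "M \<in> carrier_mat n n" by (simp add: M_def)
  have "map_mat (mpoly_eval id \<sigma>) M = 1\<^sub>m n"
    using a enF en_eq
    by (intro eq_matI) (auto simp: M_def S.hom_sum S.hom_mult)
  then have "mpoly_eval id \<sigma> (det M) = 1"
    using S.hom_det[of M] by simp
  then have "det M \<noteq> 0" using S.hom_zero by auto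
  moreover have "det M \<in> mpolys_in A"
    using M enF
    by (intro mpolys_in_det) (auto simp: M_def intro!: mpolys_in_sum mpolys_in_mult mpolys_in_const Q)
  ultimately have "poly_eval h (det M) \<noteq> 0"
    using A unfolding alg_indep_def mpolys_in_def by blast
  then have det: "det (map_mat (poly_eval h) M) \<noteq> 0"
    using H.hom_det[of M] by simp
  \<comment> \<open>The coefficients of the supposed relation form a kernel vector: each row of the
    evaluated \<open>M\<close> applies a functional to the vanishing combination.\<close>
  define w where "w = vec n (\<lambda>j. c (en j))"
  have w: "w \<in> carrier_vec n" by (simp add: w_def)
  have "w \<noteq> 0\<^sub>v n"
  proof -
    obtain e where "e \<in> F" "c e \<noteq> 0" using nz by blast
    then obtain j where "j < n" "c (en j) \<noteq> 0"
      using en by (auto simp: bij_betw_def)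
    then show ?thesis by (auto simp: w_def vec_eq_iff)
  qed
  moreover have "map_mat (poly_eval h) M *\<^sub>v w = 0\<^sub>v n"
  proof (rule eq_vecI)
    fix i assume "i < dim_vec (0\<^sub>v n :: 'k vec)"
    then have i: "i < n" by simp
    have const: "poly_eval h (mpoly_const r) = h r" for r
      by (simp add: poly_eval_eq_mpoly_eval)
    have cz: "(\<Sum>e\<in>F. ?x e v S * c e) = 0" for v S
      using fun_cong[OF fun_cong[OF c, of v], of S]
      by (simp add: sum_fun_apply ext_scale_def mult.commute)
    have "(map_mat (poly_eval h) M *\<^sub>v w) $ i
        = (\<Sum>j = 0..<n. (\<Sum>u\<in>U. h (a (en i) u) * ?x (en j) (fst u) (snd u)) * c (en j))"
      using i by (simp add: M_def w_def scalar_prod_def H.hom_sum H.hom_mult const)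
    also have "\<dots> = (\<Sum>e\<in>F. (\<Sum>u\<in>U. h (a (en i) u) * ?x e (fst u) (snd u)) * c e)"
      using en by (rule sum.reindex_bij_betw)
    also have "\<dots> = (\<Sum>u\<in>U. h (a (en i) u) * (\<Sum>e\<in>F. ?x e (fst u) (snd u) * c e))"
      unfolding sum_distrib_left sum_distrib_right mult.assoc by (rule sum.swap)
    finally show "(map_mat (poly_eval h) M *\<^sub>v w) $ i = (0\<^sub>v n) $ i"
      using i cz by simp
  qed (use M in simp)
  ultimately show False
    using det det_0_iff_vec_prod_zero_field[of "map_mat (poly_eval h) M" n] M w
    by (metis map_carrier_mat)
qed

section \<open>Exterior powers and gain graphs\<close>

lemma linear_ext_map: "Vector_Spaces.linear ext_scale ext_scale (ext_map d k A)"
  by unfold_locales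
    (auto simp: ext_map_def fun_eq_iff sum_fun_apply ext_scale_def algebra_simps sum.distrib
      sum_distrib_left)

lemma ext_map_in_ext_power: "ext_map d k A x \<in> ext_power d k"
  by (simp add: ext_map_def ext_power_def sum_fun_apply ext_scale_def wedge_def)

text \<open>The basis element \<open>e_S\<close>; for \<open>S\<close> in \<open>ksets d k\<close>
  it is a wedge of unit vectors by \<open>wedge_unit_vecs\<close>.\<close>

definition ext_unit :: "nat set \<Rightarrow> nat set \<Rightarrow> 'a::field" where
  "ext_unit S = (\<lambda>T. if T = S then 1 else 0)"

lemma ext_unit_in_ext_power: "S \<in> ksets d k \<Longrightarrow> ext_unit S \<in> ext_power d k"
  by (auto simp: ext_unit_def ext_power_def)

lemma subspace_ext_power: "ext.subspace (ext_power d k)"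
  by (auto simp: ext.subspace_def ext_power_def ext_scale_def)

lemma ext_power_expansion:
  assumes "x \<in> ext_power d k"
  shows "x = (\<Sum>S\<in>ksets d k. ext_scale (x S) (ext_unit S))"
proof
  fix T
  have "(\<Sum>S\<in>ksets d k. ext_scale (x S) (ext_unit S)) T = (\<Sum>S\<in>ksets d k. if T = S then x T else 0)"
    unfolding sum_fun_apply by (intro sum.cong) (auto simp: ext_scale_def ext_unit_def)
  also have "\<dots> = x T"
    using assms by (auto simp: ext_power_def)
  finally show "x T = (\<Sum>S\<in>ksets d k. ext_scale (x S) (ext_unit S)) T" ..
qed

lemma span_ext_unit: "ext.span (ext_unit ` ksets d k) = (ext_power d k :: (nat set \<Rightarrow> 'a::field) set)"
proof
  show "ext.span (ext_unit ` ksets d k) \<subseteq> (ext_power d k :: (nat set \<Rightarrow> 'a) set)"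
    by (intro ext.span_minimal subspace_ext_power image_subsetI ext_unit_in_ext_power)
  show "(ext_power d k :: (nat set \<Rightarrow> 'a) set) \<subseteq> ext.span (ext_unit ` ksets d k)"
  proof
    fix x :: "nat set \<Rightarrow> 'a" assume "x \<in> ext_power d k"
    then have "x = (\<Sum>S\<in>ksets d k. ext_scale (x S) (ext_unit S))"
      by (rule ext_power_expansion)
    also have "\<dots> \<in> ext.span (ext_unit ` ksets d k)"
      by (intro ext.span_sum ext.span_scale ext.span_base imageI)
    finally show "x \<in> ext.span (ext_unit ` ksets d k)" .
  qed
qed

lemma inj_ext_unit: "inj (ext_unit :: nat set \<Rightarrow> _ \<Rightarrow> 'a::field)"
  by (rule injI) (metis ext_unit_def zero_neq_one)

lemma independent_ext_unit: "ext.independent (ext_unit ` ksets d k :: (nat set \<Rightarrow> 'a::field) set)"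
  unfolding ext.dependent_finite[OF finite_imageI[OF finite_ksets]]
proof (intro notI, elim exE conjE bexE)
  fix u :: "(nat set \<Rightarrow> 'a) \<Rightarrow> 'a" and y
  assume u: "(\<Sum>y\<in>ext_unit ` ksets d k. ext_scale (u y) y) = 0"
    and y: "y \<in> ext_unit ` ksets d k" "u y \<noteq> 0"
  obtain T where T: "T \<in> ksets d k" "y = ext_unit T" using y(1) by blast
  have "(\<Sum>S\<in>ksets d k. ext_scale (u (ext_unit S)) (ext_unit S)) T = 0"
    using u by (simp add: sum.reindex[OF inj_on_subset[OF inj_ext_unit subset_UNIV]])
  also have "(\<Sum>S\<in>ksets d k. ext_scale (u (ext_unit S)) (ext_unit S)) T
      = (\<Sum>S\<in>ksets d k. if T = S then u (ext_unit T) else 0)"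
    unfolding sum_fun_apply by (intro sum.cong) (auto simp: ext_scale_def ext_unit_def)
  also have "\<dots> = u y" using T by simp
  finally show False using y(2) by simp
qed

lemma card_ext_unit: "card (ext_unit ` ksets d k :: (nat set \<Rightarrow> 'a::field) set) = d choose k"
  by (simp add: card_image[OF inj_on_subset[OF inj_ext_unit subset_UNIV]] card_ksets)

text \<open>By linearity only basis elements matter, and their images are decomposable, so
  \<open>ext_map_wedge\<close> applies to the second map.\<close>

lemma ext_map_mult:
  assumes "A \<in> carrier_mat d d" "B \<in> carrier_mat d d"
  shows "ext_map d k (A * B) x = ext_map d k A (ext_map d k B x)"
proof -
  interpret L: Vector_Spaces.linear ext_scale ext_scale "ext_map d k A" by (rule linear_ext_map)
  have "ext_map d k A (ext_map d k B x)
      = (\<Sum>S\<in>ksets d k. ext_scale (x S) (ext_map d k A (wedge d k (\<lambda>j. B *\<^sub>v unit_vec d (pick S j)))))"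
    by (simp add: ext_map_def[of d k B] L.sum L.scale)
  also have "\<dots> = (\<Sum>S\<in>ksets d k. ext_scale (x S) (wedge d k (\<lambda>j. A *\<^sub>v (B *\<^sub>v unit_vec d (pick S j)))))"
    using assms by (intro sum.cong refl arg_cong2[where f = ext_scale] ext_map_wedge)
      (auto intro: mult_mat_vec_carrier)
  also have "\<dots> = ext_map d k (A * B) x"
    using assms by (simp add: ext_map_def assoc_mult_mat_vec[of A d d B d])
  finally show ?thesis ..
qed

text \<open>\<open>ext_map\<close> discards all coordinates outside \<open>ksets d k\<close>, so the
  identity matrix acts as a projection onto the exterior power.\<close>

lemma ext_map_one:
  assumes "x \<in> ext_power d k"
  shows "ext_map d k (1\<^sub>m d) x = x"
proof -
  have "ext_map d k (1\<^sub>m d) x = (\<Sum>S\<in>ksets d k. ext_scale (x S) (ext_unit S))"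
    by (simp add: ext_map_def wedge_unit_vecs ext_unit_def)
  then show ?thesis using ext_power_expansion[OF assms] by simp
qed

section \<open>Direct sums over the vertices\<close>

definition place :: "'v \<Rightarrow> (nat set \<Rightarrow> 'a::field) \<Rightarrow> 'v \<Rightarrow> nat set \<Rightarrow> 'a" where
  "place v y = (\<lambda>u. if u = v then y else 0)"

lemma place_apply: "place v y u S = (if u = v then y S else 0)"
  by (simp add: place_def)

lemma linear_place: "Vector_Spaces.linear ext_scale fam_scale (place v)"
  by unfold_locales (auto simp: place_def fun_eq_iff ext_scale_def)

lemma inj_place: "inj (place v)"
proof (rule injI)
  fix x y assume "place v x = place v y"
  from fun_cong[OF this, of v] show "x = y" by (simp add: place_def)
qed

text \<open>Evaluating a relation at the vertex \<open>v\<close> leaves only the terms placed at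
  \<open>v\<close>, which form a relation in \<open>B v\<close>.\<close>

lemma independent_Union_place:
  fixes B :: "'v \<Rightarrow> (nat set \<Rightarrow> 'a::field) set"
  assumes U: "finite U" and fin: "\<And>v. v \<in> U \<Longrightarrow> finite (B v)"
    and ind: "\<And>v. v \<in> U \<Longrightarrow> ext.independent (B v)"
  shows "fam.independent (\<Union>v\<in>U. place v ` B v)"
    and "card (\<Union>v\<in>U. place v ` B v) = (\<Sum>v\<in>U. card (B v))"
proof -
  \<comment> \<open>The zero family is the only one that can be placed at two different vertices, so
    excluding it makes the images disjoint and their cardinalities additive.\<close>
  have nz: "0 \<notin> B v" if "v \<in> U" for v using ind[OF that] ext.dependent_zero by blast
  have disj: "place u ` B u \<inter> place v ` B v = {}" if "u \<in> U" "v \<in> U" "u \<noteq> v" for u v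
  proof (intro equals0I, elim IntE imageE)
    fix x a b assume x: "x = place u a" "x = place v b" and "a \<in> B u" "b \<in> B v"
    have "place u a u = place v b u" unfolding x(1)[symmetric] x(2)[symmetric] ..
    then have "a = 0" using that(3) by (simp add: place_def)
    then show False using nz[OF that(1)] \<open>a \<in> B u\<close> by simp
  qed
  have inj: "inj_on (place v) C" for v and C :: "(nat set \<Rightarrow> 'a) set"
    by (rule inj_on_subset[OF inj_place]) simp
  show "card (\<Union>v\<in>U. place v ` B v) = (\<Sum>v\<in>U. card (B v))"
    using U fin disj by (subst card_UN_disjoint) (auto simp: card_image[OF inj])
  have finU: "finite (\<Union>v\<in>U. place v ` B v)" using U fin by blast
  show "fam.independent (\<Union>v\<in>U. place v ` B v)"
    unfolding fam.dependent_finite[OF finU]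
  proof (intro notI, elim exE conjE bexE)
    fix c :: "('v \<Rightarrow> nat set \<Rightarrow> 'a) \<Rightarrow> 'a" and x
    assume c: "(\<Sum>y\<in>(\<Union>v\<in>U. place v ` B v). fam_scale (c y) y) = 0"
      and x: "x \<in> (\<Union>v\<in>U. place v ` B v)" "c x \<noteq> 0"
    obtain v b where v: "v \<in> U" "b \<in> B v" "x = place v b" using x(1) by blast
    have "(\<Sum>y\<in>(\<Union>v\<in>U. place v ` B v). fam_scale (c y) y)
        = (\<Sum>u\<in>U. \<Sum>y\<in>place u ` B u. fam_scale (c y) y)"
      using U fin disj by (intro sum.UNION_disjoint) auto
    also have "\<dots> = (\<Sum>u\<in>U. \<Sum>y\<in>B u. fam_scale (c (place u y)) (place u y))"
      by (simp add: sum.reindex[OF inj])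
    finally have "0 = (\<Sum>u\<in>U. \<Sum>y\<in>B u. fam_scale (c (place u y)) (place u y)) v"
      using c by simp
    also have "\<dots> = (\<Sum>u\<in>U. if v = u then \<Sum>y\<in>B v. ext_scale (c (place v y)) y else 0)"
    proof
      fix T
      show "(\<Sum>u\<in>U. \<Sum>y\<in>B u. fam_scale (c (place u y)) (place u y)) v T
          = (\<Sum>u\<in>U. if v = u then \<Sum>y\<in>B v. ext_scale (c (place v y)) y else 0) T"
        unfolding sum_fun_apply
        by (intro sum.cong refl) (auto simp: place_apply ext_scale_def sum_fun_apply)
    qed
    also have "\<dots> = (\<Sum>y\<in>B v. ext_scale (c (place v y)) y)" using U v(1) by simp
    finally have "c (place v b) = 0"
      using ext.independentD[OF ind[OF v(1)] fin[OF v(1)] subset_refl, of "\<lambda>y. c (place v y)" b] v(2)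
      by simp
    then show False using x(2) v(3) by simp
  qed
qed

section \<open>Walks, components and their roots\<close>

lemma gain_walk_append:
  "gain_walk G X u (ws @ ws') w \<longleftrightarrow> (\<exists>v. gain_walk G X u ws v \<and> gain_walk G X v ws' w)"
  by (induction G X u ws w rule: gain_walk.induct) auto

definition rev_walk :: "('e \<times> bool) list \<Rightarrow> ('e \<times> bool) list" where
  "rev_walk ws = rev (map (\<lambda>(e, b). (e, \<not> b)) ws)"

lemma gain_walk_rev: "gain_walk G X u ws v \<Longrightarrow> gain_walk G X v (rev_walk ws) u"
  by (induction G X u ws v rule: gain_walk.induct)
    (auto simp: rev_walk_def gain_walk_append split: if_splits)

lemma gain_walk_mono: "gain_walk G X u ws v \<Longrightarrow> X \<subseteq> Y \<Longrightarrow> gain_walk G Y u ws v"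
  by (induction G X u ws v rule: gain_walk.induct) (auto split: if_splits)

definition reach :: "('v, 'e) pre_digraph \<Rightarrow> 'e set \<Rightarrow> 'v \<Rightarrow> 'v \<Rightarrow> bool" where
  "reach G X u v \<longleftrightarrow> (\<exists>ws. gain_walk G X u ws v)"

lemma reach_refl: "reach G X u u"
  unfolding reach_def by (rule exI[of _ "[]"]) simp

lemma reach_sym: "reach G X u v \<Longrightarrow> reach G X v u"
  unfolding reach_def by (elim exE, rule exI, rule gain_walk_rev)

lemma reach_trans: "reach G X u v \<Longrightarrow> reach G X v w \<Longrightarrow> reach G X u w"
  unfolding reach_def by (meson gain_walk_append)

lemma reach_edge: "e \<in> X \<Longrightarrow> reach G X (tail G e) (head G e)"
  unfolding reach_def by (rule exI[of _ "[(e, True)]"]) simp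

text \<open>Testing tails suffices, since the head of an edge of \<open>X\<close> is reachable from
  its tail.\<close>

definition comp_of :: "('v, 'e) pre_digraph \<Rightarrow> 'e set \<Rightarrow> 'v \<Rightarrow> 'e set" where
  "comp_of G X v = {f \<in> X. reach G X v (tail G f)}"

text \<open>The same choice of base vertex as in \<open>gain_subgroup\<close>, so the closed walks
  counted there start at the root.\<close>

definition comp_root :: "('v, 'e) pre_digraph \<Rightarrow> 'e set \<Rightarrow> 'v \<Rightarrow> 'v" where
  "comp_root G X v = (SOME u. u \<in> edge_verts G (comp_of G X v))"

lemma comp_of_cong:
  assumes "reach G X u v"
  shows "comp_of G X u = comp_of G X v"
proof -
  have "reach G X u w \<longleftrightarrow> reach G X v w" for w
    using reach_trans[OF assms] reach_trans[OF reach_sym[OF assms]] by (rule iffI[rotated])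
  then show ?thesis by (simp add: comp_of_def)
qed

lemma comp_root_cong: "reach G X u v \<Longrightarrow> comp_root G X u = comp_root G X v"
  by (simp add: comp_root_def comp_of_cong)

lemma comp_root_reach:
  assumes "v \<in> edge_verts G X"
  shows "comp_root G X v \<in> edge_verts G X" "reach G X v (comp_root G X v)"
proof -
  obtain e where e: "e \<in> X" "v = tail G e \<or> v = head G e"
    using assms by (auto simp: edge_verts_def)
  have "reach G X v (tail G e)"
    using e(2) reach_refl[of G X v] reach_sym[OF reach_edge[OF e(1), of G]] by auto
  then have "v \<in> edge_verts G (comp_of G X v)"
    using e by (auto simp: edge_verts_def comp_of_def)
  then have "comp_root G X v \<in> edge_verts G (comp_of G X v)"
    unfolding comp_root_def by (rule someI)
  then obtain f where f: "f \<in> X" "reach G X v (tail G f)" "comp_root G X v = tail G f \<or> comp_root G X v = head G f"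
    by (auto simp: edge_verts_def comp_of_def)
  then show "comp_root G X v \<in> edge_verts G X" by (auto simp: edge_verts_def)
  show "reach G X v (comp_root G X v)"
    using f(3)
  proof
    assume "comp_root G X v = tail G f"
    then show ?thesis using f(2) by simp
  next
    assume "comp_root G X v = head G f"
    then show ?thesis using reach_trans[OF f(2) reach_edge[OF f(1)]] by simp
  qed
qed

lemma comp_root_idem: "v \<in> edge_verts G X \<Longrightarrow> comp_root G X (comp_root G X v) = comp_root G X v"
  using comp_root_cong[OF comp_root_reach(2)] by metis

text \<open>Turns sums over components into sums over root vertices; injectivity is supplied by
  \<open>inj_on_comp_of\<close>.\<close>

lemma edge_comps_eq:
  "edge_comps G X = comp_of G X ` {v \<in> edge_verts G X. comp_root G X v = v}"
proof -
  have "edge_comps G X = (\<lambda>e. comp_of G X (tail G e)) ` X"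
    by (simp add: edge_comps_def comp_of_def reach_def)
  moreover have "comp_of G X (head G e) = comp_of G X (tail G e)" if "e \<in> X" for e
    using comp_of_cong[OF reach_edge[OF that, of G]] by (rule sym)
  ultimately have "edge_comps G X = comp_of G X ` edge_verts G X"
    by (auto simp: edge_verts_def image_iff)
  also have "\<dots> = comp_of G X ` {v \<in> edge_verts G X. comp_root G X v = v}"
  proof (intro equalityI image_subsetI)
    fix v assume v: "v \<in> edge_verts G X"
    show "comp_of G X v \<in> comp_of G X ` {v \<in> edge_verts G X. comp_root G X v = v}"
      using comp_of_cong[OF comp_root_reach(2)[OF v]] comp_root_reach(1)[OF v] comp_root_idem[OF v]
      by (intro image_eqI[of _ _ "comp_root G X v"]) auto
  qed auto
  finally show ?thesis .
qed

text \<open>\<open>comp_root\<close> depends on the vertex only through the edge set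
  \<open>comp_of\<close>, so a root is recovered from its component.\<close>

lemma inj_on_comp_of: "inj_on (comp_of G X) {v. comp_root G X v = v}"
proof (rule inj_onI)
  fix u v assume uv: "u \<in> {v. comp_root G X v = v}" "v \<in> {v. comp_root G X v = v}"
    and eq: "comp_of G X u = comp_of G X v"
  have "comp_root G X u = comp_root G X v" by (simp only: comp_root_def eq)
  then show "u = v" using uv by simp
qed

lemma gain_walk_comp_of:
  "gain_walk G X u ws w \<Longrightarrow> reach G X v u \<Longrightarrow> gain_walk G (comp_of G X v) u ws w"
proof (induction ws arbitrary: u)
  case (Cons s ws)
  obtain e b where s: "s = (e, b)" by (cases s)
  have e: "e \<in> X" using Cons.prems(1) s by simp
  have u: "u = tail G e \<or> u = head G e" using Cons.prems(1) s by (auto split: if_splits)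
  have ht: "reach G X (tail G e) (head G e)" using e by (rule reach_edge)
  have "reach G X v (tail G e)" "reach G X v (head G e)"
    using u Cons.prems(2) reach_trans[OF Cons.prems(2)] ht reach_sym[OF ht] by auto
  moreover from this(1) have "e \<in> comp_of G X v" using e by (simp add: comp_of_def)
  ultimately show ?case
    using Cons.IH Cons.prems(1) s by (auto split: if_splits)
qed simp

text \<open>A walk never leaves the component in which it starts, so restricting it to
  \<open>comp_of G X v\<close> excludes nothing.\<close>

lemma gain_subgroup_comp_of:
  assumes "v \<in> edge_verts G X"
  shows "gain_subgroup \<Gamma> G \<psi> (comp_of G X v)
    = {walk_gain \<Gamma> \<psi> ws | ws. gain_walk G X (comp_root G X v) ws (comp_root G X v)}"
proof -
  have "comp_of G X v \<subseteq> X" by (auto simp: comp_of_def)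
  then have "gain_walk G (comp_of G X v) (comp_root G X v) ws (comp_root G X v)
      \<longleftrightarrow> gain_walk G X (comp_root G X v) ws (comp_root G X v)" for ws
    using gain_walk_comp_of[OF _ comp_root_reach(2)[OF assms]] gain_walk_mono by (intro iffI)
  then show ?thesis
    by (simp only: gain_subgroup_def Let_def comp_root_def[symmetric])
qed

section \<open>The count function is a rank function\<close>

text \<open>Reduces membership in a span to the basis elements \<open>ext_unit S\<close>.\<close>

lemma ext_power_preimage:
  fixes f :: "(nat set \<Rightarrow> 'a::field) \<Rightarrow> 'v \<Rightarrow> nat set \<Rightarrow> 'a"
  assumes "Vector_Spaces.linear ext_scale fam_scale f" "\<And>S. S \<in> ksets d k \<Longrightarrow> f (ext_unit S) \<in> fam.span P"
    and "y \<in> ext_power d k"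
  shows "f y \<in> fam.span P"
proof -
  interpret f: Vector_Spaces.linear ext_scale fam_scale f by (rule assms(1))
  have "f y = (\<Sum>S\<in>ksets d k. fam_scale (y S) (f (ext_unit S)))"
    using arg_cong[OF ext_power_expansion[OF assms(3)], of f] by (simp only: f.sum f.scale)
  also have "\<dots> \<in> fam.span P"
    using assms(2) by (intro fam.span_sum fam.span_scale)
  finally show ?thesis .
qed

section \<open>The induced representation and transport along walks\<close>

locale gain_rep =
  fixes \<Gamma> :: "('g, 'c) monoid_scheme" and d k :: nat and \<rho> :: "'g \<Rightarrow> 'f::field mat"
    and G :: "('v, 'e) pre_digraph" and \<psi> :: "'e \<Rightarrow> 'g"
  assumes grp: "group \<Gamma>"
    and rho: "\<rho> \<in> hom \<Gamma> (GL TYPE('f) d)"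
    and psi: "\<psi> \<in> arcs G \<rightarrow> carrier \<Gamma>"
begin

interpretation \<Gamma>: group \<Gamma> by (rule grp)

text \<open>The representation on the exterior power.\<close>

definition act :: "'g \<Rightarrow> (nat set \<Rightarrow> 'f) \<Rightarrow> nat set \<Rightarrow> 'f" where
  "act \<gamma> = ext_map d k (\<rho> \<gamma>)"

lemma rho_carrier: "\<gamma> \<in> carrier \<Gamma> \<Longrightarrow> \<rho> \<gamma> \<in> carrier_mat d d"
  using hom_in_carrier[OF rho] by (auto simp: units_of_carrier Units_def ring_mat_simps)

lemma act_mult:
  assumes "\<gamma> \<in> carrier \<Gamma>" "\<delta> \<in> carrier \<Gamma>"
  shows "act (\<gamma> \<otimes>\<^bsub>\<Gamma>\<^esub> \<delta>) x = act \<gamma> (act \<delta> x)"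
  using hom_mult[OF rho assms] ext_map_mult[OF rho_carrier rho_carrier, OF assms]
  by (simp add: act_def units_of_mult ring_mat_simps)

lemma act_one:
  assumes "x \<in> ext_power d k"
  shows "act \<one>\<^bsub>\<Gamma>\<^esub> x = x"
proof -
  interpret M: ring "ring_mat TYPE('f) d ()" by (rule ring_mat)
  have "\<rho> \<one>\<^bsub>\<Gamma>\<^esub> = \<one>\<^bsub>GL TYPE('f) d\<^esub>"
    by (rule hom_one[OF rho grp M.units_group])
  then show ?thesis
    using ext_map_one[OF assms] by (simp add: act_def units_of_one ring_mat_simps)
qed

lemma act_in_ext_power: "act \<gamma> x \<in> ext_power d k"
  by (simp add: act_def ext_map_in_ext_power)

sublocale act: Vector_Spaces.linear ext_scale ext_scale "act \<gamma>" for \<gamma>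
  unfolding act_def by (rule linear_ext_map)

sublocale place: Vector_Spaces.linear ext_scale fam_scale "place v :: _ \<Rightarrow> 'v \<Rightarrow> nat set \<Rightarrow> 'f" for v
  by (rule linear_place)

text \<open>The general element of the space \<open>A_e\<close>. For a loop both terms fall on the
  same vertex and give \<open>y - act (\<psi> e) y\<close>, the negative of the convention in
  \<open>xhat\<close>.\<close>

definition edge_vec :: "'e \<Rightarrow> (nat set \<Rightarrow> 'f) \<Rightarrow> 'v \<Rightarrow> nat set \<Rightarrow> 'f" where
  "edge_vec e y = place (head G e) y - place (tail G e) (act (\<psi> e) y)"

text \<open>The sum of the spaces \<open>A_e\<close> over the edges \<open>e\<close> of
  \<open>X\<close>.\<close>

definition edge_space :: "'e set \<Rightarrow> ('v \<Rightarrow> nat set \<Rightarrow> 'f) set" where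
  "edge_space X = fam.span (\<Union>e\<in>X. edge_vec e ` ext_unit ` ksets d k)"

lemma subspace_edge_space: "fam.subspace (edge_space X)"
  by (simp add: edge_space_def)

text \<open>The edge vector of a virtual edge from \<open>u\<close> to \<open>v\<close> with gain
  \<open>\<gamma>\<close>.\<close>

definition transport :: "'v \<Rightarrow> 'v \<Rightarrow> 'g \<Rightarrow> (nat set \<Rightarrow> 'f) \<Rightarrow> 'v \<Rightarrow> nat set \<Rightarrow> 'f" where
  "transport u v \<gamma> y = place v y - place u (act \<gamma> y)"

lemma linear_transport: "Vector_Spaces.linear ext_scale fam_scale (transport u v \<gamma>)"
  by unfold_locales
    (auto simp: transport_def place.add act.add place.scale act.scale fam.scale_right_diff_distrib)

lemma edge_vec_in_edge_space:
  assumes "e \<in> X" "y \<in> ext_power d k"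
  shows "edge_vec e y \<in> edge_space X"
proof -
  have eq: "edge_vec e = transport (tail G e) (head G e) (\<psi> e)"
    by (simp add: fun_eq_iff edge_vec_def transport_def)
  have "transport (tail G e) (head G e) (\<psi> e) y \<in> fam.span (\<Union>e\<in>X. edge_vec e ` ext_unit ` ksets d k)"
    by (rule ext_power_preimage[OF linear_transport _ assms(2)], unfold eq[symmetric])
      (intro fam.span_base UN_I[OF assms(1)] imageI)
  then show ?thesis by (simp only: edge_space_def eq)
qed

lemma walk_gain_closed:
  "gain_walk G X u ws v \<Longrightarrow> X \<subseteq> arcs G \<Longrightarrow> walk_gain \<Gamma> \<psi> ws \<in> carrier \<Gamma>"
  using psi by (induction G X u ws v rule: gain_walk.induct) (auto split: if_splits)

lemma walk_gain_append:
  assumes "gain_walk G X u ws v" "gain_walk G X v ws' w" "X \<subseteq> arcs G"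
  shows "walk_gain \<Gamma> \<psi> (ws @ ws') = walk_gain \<Gamma> \<psi> ws \<otimes>\<^bsub>\<Gamma>\<^esub> walk_gain \<Gamma> \<psi> ws'"
  using assms
proof (induction ws arbitrary: u)
  case Nil
  then show ?case using walk_gain_closed by auto
next
  case (Cons s ws)
  obtain e b where s: "s = (e, b)" by (cases s)
  have e: "\<psi> e \<in> carrier \<Gamma>" using Cons.prems(1,3) psi s by auto
  obtain u' where u': "gain_walk G X u' ws v"
    using Cons.prems(1) s by (auto split: if_splits)
  have "walk_gain \<Gamma> \<psi> ws \<in> carrier \<Gamma>" "walk_gain \<Gamma> \<psi> ws' \<in> carrier \<Gamma>"
    using walk_gain_closed u' Cons.prems(2,3) by blast+
  then show ?case
    using Cons.IH[OF u' Cons.prems(2,3)] e s by (simp add: \<Gamma>.m_assoc)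
qed

lemma walk_gain_rev:
  assumes "gain_walk G X u ws v" "X \<subseteq> arcs G"
  shows "walk_gain \<Gamma> \<psi> (rev_walk ws) = inv\<^bsub>\<Gamma>\<^esub> walk_gain \<Gamma> \<psi> ws"
  using assms
proof (induction ws arbitrary: u)
  case Nil
  then show ?case by (simp add: rev_walk_def)
next
  case (Cons s ws)
  obtain e b where s: "s = (e, b)" by (cases s)
  have eX: "e \<in> X" using Cons.prems(1) s by simp
  then have e: "\<psi> e \<in> carrier \<Gamma>" using Cons.prems(2) psi by auto
  define u' where "u' = (if b then head G e else tail G e)"
  have u': "gain_walk G X u' ws v" "gain_walk G X u' [(e, \<not> b)] u"
    using Cons.prems(1) s eX by (auto simp: u'_def split: if_splits)
  have "rev_walk (s # ws) = rev_walk ws @ [(e, \<not> b)]" by (simp add: rev_walk_def s)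
  then have "walk_gain \<Gamma> \<psi> (rev_walk (s # ws))
      = inv\<^bsub>\<Gamma>\<^esub> walk_gain \<Gamma> \<psi> ws \<otimes>\<^bsub>\<Gamma>\<^esub> walk_gain \<Gamma> \<psi> [(e, \<not> b)]"
    using walk_gain_append[OF gain_walk_rev[OF u'(1)] u'(2) Cons.prems(2)]
      Cons.IH[OF u'(1) Cons.prems(2)] by simp
  then show ?case
    using s e walk_gain_closed[OF u'(1) Cons.prems(2)] by (simp add: \<Gamma>.inv_mult_group)
qed

text \<open>Transport along a walk telescopes into the transports of its steps. A forward step gives
  an edge vector, a backward step the negative of one.\<close>

lemma transport_walk:
  assumes "gain_walk G X u ws v" "X \<subseteq> arcs G" "y \<in> ext_power d k"
  shows "transport u v (walk_gain \<Gamma> \<psi> ws) y \<in> edge_space X"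
  using assms(1)
proof (induction ws arbitrary: u)
  case Nil
  then have "transport u v (walk_gain \<Gamma> \<psi> []) y = 0"
    using act_one[OF assms(3)] by (simp add: transport_def)
  then show ?case by (simp only: fam.subspace_0[OF subspace_edge_space])
next
  case (Cons s ws)
  obtain e b where s: "s = (e, b)" by (cases s)
  have eX: "e \<in> X" using Cons.prems s by simp
  then have e: "\<psi> e \<in> carrier \<Gamma>" using assms(2) psi by auto
  define u' where "u' = (if b then head G e else tail G e)"
  have u': "gain_walk G X u' ws v"
    using Cons.prems s by (auto simp: u'_def split: if_splits)
  define \<gamma> where "\<gamma> = (if b then \<psi> e else inv\<^bsub>\<Gamma>\<^esub> \<psi> e)"
  \<comment> \<open>The first step acts on the vector that the rest of the walk has already
    moved.\<close>
  define z where "z = act (walk_gain \<Gamma> \<psi> ws) y"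
  have z: "z \<in> ext_power d k" by (simp add: z_def act_in_ext_power)
  have step: "transport u u' \<gamma> z \<in> edge_space X"
  proof (cases b)
    case True
    then show ?thesis
      using edge_vec_in_edge_space[OF eX z] Cons.prems s
      by (simp add: transport_def edge_vec_def u'_def \<gamma>_def)
  next
    case False
    have "act (\<psi> e) (act (inv\<^bsub>\<Gamma>\<^esub> \<psi> e) z) = z"
      using act_mult[of "\<psi> e" "inv\<^bsub>\<Gamma>\<^esub> \<psi> e" z] act_one[OF z] e by simp
    then have "transport u u' \<gamma> z = - edge_vec e (act (inv\<^bsub>\<Gamma>\<^esub> \<psi> e) z)"
      using False Cons.prems s by (simp add: transport_def edge_vec_def u'_def \<gamma>_def)
    then show ?thesis
      by (simp only: fam.subspace_neg[OF subspace_edge_space edge_vec_in_edge_space[OF eX act_in_ext_power]])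
  qed
  have "act (walk_gain \<Gamma> \<psi> (s # ws)) y = act \<gamma> z"
    using act_mult[of \<gamma> "walk_gain \<Gamma> \<psi> ws" y] e walk_gain_closed[OF u' assms(2)]
    by (simp add: s \<gamma>_def z_def)
  then have "transport u v (walk_gain \<Gamma> \<psi> (s # ws)) y
      = transport u' v (walk_gain \<Gamma> \<psi> ws) y + transport u u' \<gamma> z"
    by (simp add: transport_def z_def)
  then show ?case
    by (simp only: fam.subspace_add[OF subspace_edge_space Cons.IH[OF u'] step])
qed

text \<open>
  Up to the unipotent automorphism \<open>shear\<close>, which moves the coordinate of every non-root vertex to
  the root of its component, the edge space of \<open>X\<close> is a direct sum of full copies of the exterior
  power at the non-root vertices and of the spaces spanned by \<open>\<gamma> y - y\<close> at the roots.
\<close>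

definition tree_gain :: "'e set \<Rightarrow> 'v \<Rightarrow> 'g" where
  "tree_gain X v = walk_gain \<Gamma> \<psi> (SOME ws. gain_walk G X (comp_root G X v) ws v)"

text \<open>The walks are chosen vertex by vertex and need not form a tree; at a root the walk is an
  arbitrary closed one, possibly with nontrivial gain.\<close>

lemma tree_gain_walk:
  assumes "v \<in> edge_verts G X"
  obtains ws where "gain_walk G X (comp_root G X v) ws v" "tree_gain X v = walk_gain \<Gamma> \<psi> ws"
proof
  have "\<exists>ws. gain_walk G X (comp_root G X v) ws v"
    using reach_sym[OF comp_root_reach(2)[OF assms]] by (simp add: reach_def)
  then show "gain_walk G X (comp_root G X v) (SOME ws. gain_walk G X (comp_root G X v) ws v) v"
    by (rule someI_ex)
qed (simp add: tree_gain_def)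

definition gain_space :: "'e set \<Rightarrow> 'v \<Rightarrow> (nat set \<Rightarrow> 'f) set" where
  "gain_space X r = ext.span (\<Union>\<gamma>\<in>gain_subgroup \<Gamma> G \<psi> (comp_of G X r).
    (\<lambda>y. act \<gamma> y - y) ` ext_power d k)"

lemma dim_gain_space: "ext.dim (gain_space X r) = d_rep d k \<rho> (gain_subgroup \<Gamma> G \<psi> (comp_of G X r))"
  by (simp add: gain_space_def d_rep_def act_def)

lemma closed_walk_gain_space:
  assumes "r \<in> edge_verts G X" "comp_root G X r = r" "gain_walk G X r ws r" "y \<in> ext_power d k"
  shows "act (walk_gain \<Gamma> \<psi> ws) y - y \<in> gain_space X r"
  unfolding gain_space_def gain_subgroup_comp_of[OF assms(1)] assms(2)
  using assms(3,4) by (intro ext.span_base) blast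

definition nonroots :: "'e set \<Rightarrow> 'v set" where
  "nonroots X = {v \<in> edge_verts G X. comp_root G X v \<noteq> v}"

definition roots :: "'e set \<Rightarrow> 'v set" where
  "roots X = {v \<in> edge_verts G X. comp_root G X v = v}"

definition shear :: "'e set \<Rightarrow> ('v \<Rightarrow> nat set \<Rightarrow> 'f) \<Rightarrow> 'v \<Rightarrow> nat set \<Rightarrow> 'f" where
  "shear X x = x - (\<Sum>v\<in>nonroots X. place (comp_root G X v) (act (tree_gain X v) (x v)))"

lemma linear_shear: "Vector_Spaces.linear fam_scale fam_scale (shear X)"
proof unfold_locales
  fix x y c
  show "shear X (x + y) = shear X x + shear X y"
    by (simp add: shear_def act.add place.add sum.distrib)
  have "(fam_scale c x) v = ext_scale c (x v)" for v by (simp add: fam_scale_def)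
  then show "shear X (fam_scale c x) = fam_scale c (shear X x)"
    by (simp add: shear_def act.scale place.scale fam.scale_right_diff_distrib fam.scale_sum_right)
qed

lemma shear_place:
  assumes "finite X"
  shows "v \<in> nonroots X \<Longrightarrow> shear X (place v y) = transport (comp_root G X v) v (tree_gain X v) y"
    and "v \<notin> nonroots X \<Longrightarrow> shear X (place v y) = place v y"
proof -
  have fin: "finite (nonroots X)"
    using assms by (simp add: nonroots_def edge_verts_def)
  have "(\<Sum>u\<in>nonroots X. place (comp_root G X u) (act (tree_gain X u) (place v y u)))
      = (\<Sum>u\<in>nonroots X. if v = u then place (comp_root G X v) (act (tree_gain X v) y) else 0)"
    by (intro sum.cong refl) (auto simp: place_def[of v] act.zero place.zero)
  also have "\<dots> = (if v \<in> nonroots X then place (comp_root G X v) (act (tree_gain X v) y) else 0)"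
    using fin by simp
  finally show "v \<in> nonroots X \<Longrightarrow> shear X (place v y) = transport (comp_root G X v) v (tree_gain X v) y"
    "v \<notin> nonroots X \<Longrightarrow> shear X (place v y) = place v y"
    by (simp_all add: shear_def transport_def)
qed

text \<open>All corrections land at roots, so coordinates at non-roots are unchanged. If these
  vanish, so do the corrections, and nothing remains of the shear.\<close>

lemma inj_shear: "inj (shear X)"
proof -
  interpret shear: Vector_Spaces.linear fam_scale fam_scale "shear X" by (rule linear_shear)
  show ?thesis
    unfolding shear.inj_iff_eq_0
  proof (intro allI impI)
    fix x assume z: "shear X x = 0"
    have "x v = 0" if v: "v \<in> nonroots X" for v
    proof -
      have neq: "v \<noteq> comp_root G X u" if "u \<in> nonroots X" for u
        using comp_root_idem[of u G X] that v by (auto simp: nonroots_def)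
      then have "(\<Sum>u\<in>nonroots X. place (comp_root G X u) (act (tree_gain X u) (x u))) v = 0"
        by (auto simp: fun_eq_iff sum_fun_apply place_apply neq intro!: sum.neutral)
      then have "shear X x v = x v" by (simp add: shear_def)
      then show ?thesis using z by simp
    qed
    then show "x = 0"
      using z by (simp add: shear_def act.zero place.zero)
  qed
qed

text \<open>The basis is the image under \<open>shear\<close> of the elements \<open>e_S\<close>
  placed at every non-root and of a basis of the gain space placed at every root. Injectivity of
  \<open>shear\<close> gives independence, and walks from the roots give both inclusions between the
  spans.\<close>

theorem edge_space_dim:
  assumes "finite X" "X \<subseteq> arcs G"
  shows "\<exists>B. finite B \<and> fam.independent B \<and> fam.span B = edge_space X \<and>
    int (card B) = f_rep \<Gamma> d k \<rho> G \<psi> X"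
proof -
  interpret shear: Vector_Spaces.linear fam_scale fam_scale "shear X" by (rule linear_shear)
  let ?V = "edge_verts G X"
  let ?u = "ext_unit ` ksets d k :: (nat set \<Rightarrow> 'f) set"
  have finV: "finite ?V" using assms(1) by (simp add: edge_verts_def)
  have V: "?V = nonroots X \<union> roots X" "nonroots X \<inter> roots X = {}"
    by (auto simp: nonroots_def roots_def)
  have finNR: "finite (nonroots X)" "finite (roots X)"
    using finV V(1) by auto
  have "\<forall>r. \<exists>C. C \<subseteq> gain_space X r \<and> ext.independent C \<and> gain_space X r \<subseteq> ext.span C
      \<and> card C = ext.dim (gain_space X r)"
  proof
    fix r
    show "\<exists>C. C \<subseteq> gain_space X r \<and> ext.independent C \<and> gain_space X r \<subseteq> ext.span C
        \<and> card C = ext.dim (gain_space X r)"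
      by (rule ext.basis_exists[of "gain_space X r"]) (intro exI conjI)
  qed
  from choice[OF this] obtain C where
    C: "\<And>r. C r \<subseteq> gain_space X r" "\<And>r. ext.independent (C r)" "\<And>r. gain_space X r \<subseteq> ext.span (C r)"
      "\<And>r. card (C r) = ext.dim (gain_space X r)"
    by blast
  have gs: "gain_space X r \<subseteq> ext_power d k" for r
    unfolding gain_space_def using act_in_ext_power subspace_ext_power
    by (intro ext.span_minimal) (auto intro: ext.subspace_diff)
  \<comment> \<open>The gain space lies in the exterior power, whose finite spanning set bounds any
    independent subset.\<close>
  have finC: "finite (C r)" for r
    using ext.independent_span_bound[of ?u "C r"] C(1,2)[of r] gs[of r] span_ext_unit[of d k, where 'a = 'f]
    by auto
  define B where "B v = (if v \<in> nonroots X then ?u else C v)" for v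
  define P where "P = (\<Union>v\<in>?V. place v ` B v)"
  have B: "finite (B v)" "ext.independent (B v)" for v
    using finC C(2) independent_ext_unit by (auto simp: B_def)
  have P: "fam.independent P" "card P = (\<Sum>v\<in>?V. card (B v))"
    unfolding P_def using independent_Union_place[OF finV B] by auto
  have finP: "finite P" using finV B(1) by (auto simp: P_def)
  have ind: "fam.independent (shear X ` P)"
    by (rule shear.independent_injective_image[OF P(1)]) (rule inj_on_subset[OF inj_shear subset_UNIV])

  have nonroot: "transport (comp_root G X v) v (tree_gain X v) y \<in> fam.span (shear X ` P)"
    if v: "v \<in> nonroots X" and y: "y \<in> ext_power d k" for v y
  proof (rule ext_power_preimage[OF linear_transport _ y])
    fix S assume "S \<in> ksets d k"
    then have "place v (ext_unit S) \<in> P"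
      using v by (auto simp: P_def B_def nonroots_def intro!: bexI[of _ v])
    then show "transport (comp_root G X v) v (tree_gain X v) (ext_unit S) \<in> fam.span (shear X ` P)"
      unfolding shear_place(1)[OF assms(1) v, symmetric] by (intro fam.span_base imageI)
  qed
  have root: "place r y \<in> fam.span (shear X ` P)" if r: "r \<in> roots X" and y: "y \<in> gain_space X r" for r y
  proof -
    have "place r ` C r \<subseteq> shear X ` P"
    proof (intro image_subsetI)
      fix c assume "c \<in> C r"
      then have "place r c \<in> P"
        using r by (auto simp: P_def B_def roots_def nonroots_def intro!: bexI[of _ r])
      moreover have "shear X (place r c) = place r c"
        using r by (intro shear_place(2)[OF assms(1)]) (auto simp: roots_def nonroots_def)
      ultimately show "place r c \<in> shear X ` P" by (metis imageI)
    qed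
    then have "place r ` ext.span (C r) \<subseteq> fam.span (shear X ` P)"
      unfolding place.span_image[symmetric] by (rule fam.span_mono)
    then show ?thesis using C(3)[of r] y by blast
  qed
  \<comment> \<open>For a root, \<open>tree_gain\<close> is the gain of a closed walk, so the
    transport is, up to sign, a placed element of the gain space.\<close>
  have vertex: "transport (comp_root G X v) v (tree_gain X v) y \<in> fam.span (shear X ` P)"
    if v: "v \<in> ?V" and y: "y \<in> ext_power d k" for v y
  proof (cases "v \<in> nonroots X")
    case True
    then show ?thesis by (rule nonroot[OF _ y])
  next
    case False
    then have r: "v \<in> roots X" "comp_root G X v = v" using v False by (auto simp: roots_def nonroots_def)
    obtain ws where ws: "gain_walk G X (comp_root G X v) ws v" "tree_gain X v = walk_gain \<Gamma> \<psi> ws"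
      using tree_gain_walk[OF v] .
    have "act (tree_gain X v) y - y \<in> gain_space X v"
      unfolding ws(2) by (rule closed_walk_gain_space[OF v r(2) ws(1)[unfolded r(2)] y])
    from fam.span_neg[OF root[OF r(1) this]]
    have "- place v (act (tree_gain X v) y - y) \<in> fam.span (shear X ` P)" .
    moreover have "transport v v (tree_gain X v) y = - place v (act (tree_gain X v) y - y)"
      unfolding transport_def place.diff by (rule minus_diff_eq[symmetric])
    ultimately show ?thesis unfolding r(2) by (simp only:)
  qed

  \<comment> \<open>Each edge vector is the difference of the transports from the root to its two
    ends, up to an error at the root that a closed walk through the edge puts into the gain
    space.\<close>
  have "edge_space X \<subseteq> fam.span (shear X ` P)"
    unfolding edge_space_def
  proof (intro fam.span_minimal fam.subspace_span subsetI, elim UN_E imageE)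
    fix x e y S assume e: "e \<in> X" and x: "x = edge_vec e y" "y = ext_unit S" "S \<in> ksets d k"
    have y: "y \<in> ext_power d k" using x by (simp add: ext_unit_in_ext_power)
    let ?h = "head G e" and ?t = "tail G e"
    define r where "r = comp_root G X ?t"
    have ht: "?h \<in> ?V" "?t \<in> ?V" using e by (auto simp: edge_verts_def)
    have rh: "comp_root G X ?h = r" using comp_root_cong[OF reach_edge[OF e, of G]] by (simp add: r_def)
    have r: "r \<in> roots X" "r \<in> ?V" "comp_root G X r = r"
      using comp_root_reach(1)[OF ht(2)] comp_root_idem[OF ht(2)] by (auto simp: roots_def r_def)
    obtain wh where wh: "gain_walk G X r wh ?h" "tree_gain X ?h = walk_gain \<Gamma> \<psi> wh"
      using tree_gain_walk[OF ht(1)] unfolding rh .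
    obtain wt where wt: "gain_walk G X r wt ?t" "tree_gain X ?t = walk_gain \<Gamma> \<psi> wt"
      using tree_gain_walk[OF ht(2)] unfolding r_def .
    define gh where "gh = tree_gain X ?h"
    define gt where "gt = tree_gain X ?t"
    have car: "gh \<in> carrier \<Gamma>" "gt \<in> carrier \<Gamma>" "\<psi> e \<in> carrier \<Gamma>"
      using walk_gain_closed[OF wh(1) assms(2)] walk_gain_closed[OF wt(1) assms(2)] psi assms(2) e
      by (auto simp: gh_def gt_def wh(2) wt(2))
    \<comment> \<open>From the root to the tail, across \<open>e\<close>, and back from the head to
      the root.\<close>
    define wc where "wc = wt @ [(e, True)] @ rev_walk wh"
    have we: "gain_walk G X ?t [(e, True)] ?h" using e by simp
    have wr: "gain_walk G X ?h (rev_walk wh) r" by (rule gain_walk_rev[OF wh(1)])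
    have we': "gain_walk G X ?t ([(e, True)] @ rev_walk wh) r"
      by (rule gain_walk_append[THEN iffD2, OF exI, OF conjI, OF we wr])
    have wc: "gain_walk G X r wc r"
      unfolding wc_def by (rule gain_walk_append[THEN iffD2, OF exI, OF conjI, OF wt(1) we'])
    have gc: "walk_gain \<Gamma> \<psi> wc = gt \<otimes>\<^bsub>\<Gamma>\<^esub> \<psi> e \<otimes>\<^bsub>\<Gamma>\<^esub> inv\<^bsub>\<Gamma>\<^esub> gh"
      unfolding wc_def walk_gain_append[OF wt(1) we' assms(2)] walk_gain_append[OF we wr assms(2)]
        walk_gain_rev[OF wh(1) assms(2)] gh_def gt_def wh(2)[symmetric] wt(2)[symmetric]
      using car by (simp add: gh_def gt_def \<Gamma>.m_assoc)
    \<comment> \<open>Letting the closed walk act on \<open>act gh y\<close> cancels the inverse of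
      \<open>gh\<close> and leaves exactly the error at the root.\<close>
    have "gt \<otimes>\<^bsub>\<Gamma>\<^esub> \<psi> e \<otimes>\<^bsub>\<Gamma>\<^esub> inv\<^bsub>\<Gamma>\<^esub> gh \<otimes>\<^bsub>\<Gamma>\<^esub> gh = gt \<otimes>\<^bsub>\<Gamma>\<^esub> \<psi> e"
      using car by (simp add: \<Gamma>.m_assoc)
    then have "act (walk_gain \<Gamma> \<psi> wc) (act gh y) = act gt (act (\<psi> e) y)"
      using act_mult[of "gt \<otimes>\<^bsub>\<Gamma>\<^esub> \<psi> e \<otimes>\<^bsub>\<Gamma>\<^esub> inv\<^bsub>\<Gamma>\<^esub> gh" gh y] act_mult[of gt "\<psi> e" y] car
      by (simp add: gc)
    then have mid: "act gt (act (\<psi> e) y) - act gh y \<in> gain_space X r"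
      using closed_walk_gain_space[OF r(2,3) wc act_in_ext_power, of gh y] by simp
    have "edge_vec e y = transport r ?h gh y - transport r ?t gt (act (\<psi> e) y)
        - place r (act gt (act (\<psi> e) y) - act gh y)"
      by (simp add: edge_vec_def transport_def place.diff)
    then show "x \<in> fam.span (shear X ` P)"
      using fam.span_diff[OF fam.span_diff[OF vertex[OF ht(1) y] vertex[OF ht(2) act_in_ext_power]]
          root[OF r(1) mid]] x(1) rh
      by (simp add: gh_def gt_def r_def)
  qed
  \<comment> \<open>Conversely, the sheared vector at a non-root is a transport along a walk from
    its root. At a root, the generators of the gain space are negatives of transports along closed
    walks.\<close>
  moreover have "fam.span (shear X ` P) \<subseteq> edge_space X"
    unfolding edge_space_def
  proof (intro fam.span_minimal fam.subspace_span image_subsetI)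
    fix x assume "x \<in> P"
    then obtain v b where v: "v \<in> ?V" "b \<in> B v" "x = place v b" by (auto simp: P_def)
    show "shear X x \<in> fam.span (\<Union>e\<in>X. edge_vec e ` ext_unit ` ksets d k)"
    proof (cases "v \<in> nonroots X")
      case True
      obtain ws where ws: "gain_walk G X (comp_root G X v) ws v" "tree_gain X v = walk_gain \<Gamma> \<psi> ws"
        using tree_gain_walk[OF v(1)] .
      have "b \<in> ext_power d k"
        using v(2) True ext_unit_in_ext_power by (auto simp: B_def)
      then show ?thesis
        using transport_walk[OF ws(1) assms(2)] ws(2)
        by (simp add: v(3) shear_place(1)[OF assms(1) True] edge_space_def)
    next
      case False
      then have r: "comp_root G X v = v" using v(1) by (auto simp: nonroots_def)
      have "b \<in> gain_space X v" using v(2) False C(1) by (auto simp: B_def)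
      moreover have "place v ` gain_space X v \<subseteq> edge_space X"
        unfolding gain_space_def place.span_image[symmetric] edge_space_def
      proof (intro fam.span_minimal fam.subspace_span image_subsetI, elim UN_E imageE)
        fix z \<gamma> y
        assume \<gamma>: "\<gamma> \<in> gain_subgroup \<Gamma> G \<psi> (comp_of G X v)" and z: "z = act \<gamma> y - y" "y \<in> ext_power d k"
        then obtain ws where ws: "gain_walk G X v ws v" "\<gamma> = walk_gain \<Gamma> \<psi> ws"
          by (auto simp: gain_subgroup_comp_of[OF v(1)] r)
        have "place v z = - transport v v \<gamma> y"
          by (simp add: z(1) transport_def place.diff)
        then show "place v z \<in> fam.span (\<Union>e\<in>X. edge_vec e ` ext_unit ` ksets d k)"
          using fam.span_neg transport_walk[OF ws(1) assms(2) z(2)] ws(2)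
          by (simp add: edge_space_def)
      qed
      ultimately show ?thesis
        using v(3) False by (auto simp: shear_place(2)[OF assms(1) False] edge_space_def)
    qed
  qed
  ultimately have span: "fam.span (shear X ` P) = edge_space X" by blast

  have "card (shear X ` P) = (\<Sum>v\<in>?V. card (B v))"
    using P(2) card_image[OF inj_on_subset[OF inj_shear subset_UNIV], of X P] by simp
  also have "\<dots> = (\<Sum>v\<in>nonroots X. card (B v)) + (\<Sum>v\<in>roots X. card (B v))"
    unfolding V(1) using finNR V(2) by (rule sum.union_disjoint)
  also have "(\<Sum>v\<in>nonroots X. card (B v)) = (d choose k) * card (nonroots X)"
    by (simp add: B_def card_ext_unit)
  also have "(\<Sum>r\<in>roots X. card (B r)) = (\<Sum>r\<in>roots X. d_rep d k \<rho> (gain_subgroup \<Gamma> G \<psi> (comp_of G X r)))"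
    using V(2) by (intro sum.cong refl) (auto simp: B_def C(4) dim_gain_space)
  finally have cardB: "card (shear X ` P) = (d choose k) * card (nonroots X)
      + (\<Sum>r\<in>roots X. d_rep d k \<rho> (gain_subgroup \<Gamma> G \<psi> (comp_of G X r)))" .

  \<comment> \<open>Roots correspond bijectively to components, so the number of non-roots is the
    number of vertices minus the number of components.\<close>
  have comps: "edge_comps G X = comp_of G X ` roots X"
    by (simp add: edge_comps_eq roots_def)
  have inj: "inj_on (comp_of G X) (roots X)"
    by (rule inj_on_subset[OF inj_on_comp_of]) (auto simp: roots_def)
  have "card ?V = card (nonroots X) + card (roots X)"
    unfolding V(1) using finNR V(2) by (rule card_Un_disjoint)
  then have "f_rep \<Gamma> d k \<rho> G \<psi> X = int (d choose k) * int (card (nonroots X))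
      + (\<Sum>r\<in>roots X. int (d_rep d k \<rho> (gain_subgroup \<Gamma> G \<psi> (comp_of G X r))))"
    by (simp add: f_rep_def comps card_image[OF inj] sum.reindex[OF inj] algebra_simps)
  then have "int (card (shear X ` P)) = f_rep \<Gamma> d k \<rho> G \<psi> X"
    by (simp add: cardB)
  then show ?thesis
    using ind span finP by (intro exI[of _ "shear X ` P"]) auto
qed

end

section \<open>The matroid of generic decomposable vectors\<close>

lemma lin_indep_family_cong:
  assumes "\<And>e. e \<in> F \<Longrightarrow> x e = y e"
  shows "lin_indep_family x F \<longleftrightarrow> lin_indep_family y F"
proof -
  have "(\<Sum>e\<in>F. (\<lambda>v. ext_scale (c e) (x e v))) = (\<Sum>e\<in>F. (\<lambda>v. ext_scale (c e) (y e v)))" for c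
    using assms by (intro sum.cong) auto
  then show ?thesis unfolding lin_indep_family_def by simp
qed

lemma (in comm_ring_hom) det_mat_hom:
  "det (mat k k (\<lambda>(i, j). hom (a i j))) = hom (det (mat k k (\<lambda>(i, j). a i j)))"
proof -
  have "mat k k (\<lambda>(i, j). hom (a i j)) = map_mat hom (mat k k (\<lambda>(i, j). a i j))"
    by (intro eq_matI) auto
  then show ?thesis by simp
qed

section \<open>Passage to the larger field\<close>

lemma wedge_hom:
  assumes h: "field_hom h" and v: "\<And>j. j < k \<Longrightarrow> v j \<in> carrier_vec d"
  shows "wedge d k (\<lambda>j. map_vec h (v j)) T = h (wedge d k v T)"
proof (cases "T \<in> ksets d k")
  case True
  interpret field_hom h by (rule h)
  have "mat k k (\<lambda>(i, j). map_vec h (v j) $ pick T i) = mat k k (\<lambda>(i, j). h (v j $ pick T i))"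
    using carrier_vecD[OF v] ksets_pick_less[OF True] by (intro eq_matI) auto
  then show ?thesis using True det_mat_hom by (simp add: wedge_def)
next
  case False
  interpret field_hom h by (rule h)
  show ?thesis using False by (simp add: wedge_def)
qed

text \<open>Applying \<open>h\<close> coordinatewise is semilinear, so a combination is carried to
  the combination whose scalars are the images under \<open>h\<close>. Hence a spanning set over the
  small field bounds the rank over the large one.\<close>

lemma span_hom:
  fixes h :: "'f::field \<Rightarrow> 'k::field" and y :: "'v \<Rightarrow> nat set \<Rightarrow> 'f"
  assumes h: "field_hom h" and y: "y \<in> fam.span B"
  shows "(\<lambda>v S. h (y v S)) \<in> fam.span ((\<lambda>b v S. h (b v S)) ` B)"
proof -
  interpret field_hom h by (rule h)
  let ?H = "\<lambda>(b :: 'v \<Rightarrow> nat set \<Rightarrow> 'f) v S. h (b v S)"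
  have "fam.subspace {y. ?H y \<in> fam.span (?H ` B)}"
  proof (intro fam.subspaceI CollectI; (elim CollectE)?)
    have "?H 0 = 0" by (simp add: fun_eq_iff)
    then show "?H 0 \<in> fam.span (?H ` B)" by (simp only: fam.span_zero)
  next
    fix x y assume xy: "?H x \<in> fam.span (?H ` B)" "?H y \<in> fam.span (?H ` B)"
    have "?H (x + y) = ?H x + ?H y" by (simp add: fun_eq_iff hom_add)
    then show "?H (x + y) \<in> fam.span (?H ` B)" by (simp only: fam.span_add[OF xy])
  next
    fix c x assume x: "?H x \<in> fam.span (?H ` B)"
    have "?H (fam_scale c x) = fam_scale (h c) (?H x)" by (simp add: fun_eq_iff hom_mult)
    then show "?H (fam_scale c x) \<in> fam.span (?H ` B)" by (simp only: fam.span_scale[OF x])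
  qed
  moreover have "B \<subseteq> {y. ?H y \<in> fam.span (?H ` B)}"
    by (auto intro: fam.span_base)
  ultimately show ?thesis using fam.span_minimal y by blast
qed

text \<open>Expand the wedge in the basis \<open>e_S\<close>. The matrix entries of the induced
  endomorphism are minors of \<open>M\<close>, which commute with \<open>h\<close>.\<close>

lemma wedge_expansion_hom:
  fixes h :: "'f::field \<Rightarrow> 'k::field"
  assumes h: "field_hom h" and M: "M \<in> carrier_mat d d" and q: "\<And>i. i < k \<Longrightarrow> q i \<in> carrier_vec d"
  shows "wedge d k (\<lambda>i. map_mat h M *\<^sub>v q i) T
    = (\<Sum>S\<in>ksets d k. wedge d k q S * h (ext_map d k M (ext_unit S) T))"
proof -
  interpret field_hom h by (rule h)
  have hM: "map_mat h M \<in> carrier_mat d d" using M by simp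
  have "wedge d k (\<lambda>i. map_mat h M *\<^sub>v q i) T = ext_map d k (map_mat h M) (wedge d k q) T"
    by (simp add: ext_map_wedge[OF hM q])
  also have "\<dots> = (\<Sum>S\<in>ksets d k. wedge d k q S
      * wedge d k (\<lambda>j. map_mat h M *\<^sub>v unit_vec d (pick S j)) T)"
    by (simp add: ext_map_def sum_fun_apply ext_scale_def)
  also have "\<dots> = (\<Sum>S\<in>ksets d k. wedge d k q S * h (ext_map d k M (ext_unit S) T))"
  proof (intro sum.cong refl arg_cong2[where f = times])
    fix S assume S: "S \<in> ksets d k"
    have "map_mat h M *\<^sub>v unit_vec d (pick S j) = map_vec h (M *\<^sub>v unit_vec d (pick S j))" for j
    proof -
      have "map_vec h (unit_vec d (pick S j)) = unit_vec d (pick S j)"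
        by (intro eq_vecI) (auto simp: unit_vec_def)
      then show ?thesis
        using mult_mat_vec_hom[OF M unit_vec_carrier[of d "pick S j"]] by simp
    qed
    then have "wedge d k (\<lambda>j. map_mat h M *\<^sub>v unit_vec d (pick S j)) T
        = h (wedge d k (\<lambda>j. M *\<^sub>v unit_vec d (pick S j)) T)"
      using wedge_hom[OF h, of k "\<lambda>j. M *\<^sub>v unit_vec d (pick S j)" d T] M
      by (simp add: mult_mat_vec_carrier[OF M])
    also have "wedge d k (\<lambda>j. M *\<^sub>v unit_vec d (pick S j)) = ext_map d k M (ext_unit S)"
      using ext_map_wedge[OF M, of k "\<lambda>j. unit_vec d (pick S j)"] wedge_unit_vecs[OF S, where 'a = 'f]
      by (simp add: ext_unit_def)
    finally show "wedge d k (\<lambda>j. map_mat h M *\<^sub>v unit_vec d (pick S j)) T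
        = h (ext_map d k M (ext_unit S) T)" .
  qed
  finally show ?thesis .
qed

section \<open>The edge vectors of the theorem and the two directions of the count\<close>

context gain_rep
begin

text \<open>The vector of \<open>e\<close> when its attached vectors are the unit vectors indexed by
  \<open>S\<close>, over the small field; the case distinction restores the sign of
  \<open>xhat\<close> at loops.\<close>

definition edge_xvec :: "'e \<Rightarrow> nat set \<Rightarrow> 'v \<Rightarrow> nat set \<Rightarrow> 'f" where
  "edge_xvec e S = (if tail G e = head G e then - edge_vec e (ext_unit S) else edge_vec e (ext_unit S))"

lemma edge_xvec_supp:
  assumes "S \<in> ksets d k" "v \<notin> {tail G e, head G e} \<or> T \<notin> ksets d k"
  shows "edge_xvec e S v T = 0"
  using assms ext_unit_in_ext_power[OF assms(1), where 'a = 'f] act_in_ext_power[of "\<psi> e" "ext_unit S"]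
  by (auto simp: edge_xvec_def edge_vec_def place_apply ext_power_def)

text \<open>The attached vectors enter only through the coordinates of their wedge, and enter
  linearly, with coefficients from the small field. This places \<open>xhat\<close> in the scalar
  extension of \<open>A_e\<close> and later turns it into a polynomial vector.\<close>

lemma xhat_expansion:
  fixes h :: "'f \<Rightarrow> 'k::field"
  assumes h: "field_hom h" and e: "e \<in> arcs G" and p: "\<And>i. i < k \<Longrightarrow> p e i \<in> carrier_vec d"
  shows "xhat d k h \<rho> G \<psi> p e v T = (\<Sum>S\<in>ksets d k. wedge d k (p e) S * h (edge_xvec e S v T))"
proof -
  interpret field_hom h by (rule h)
  define w where "w = wedge d k (p e)"
  define w' where "w' = wedge d k (\<lambda>i. map_mat h (\<rho> (\<psi> e)) *\<^sub>v p e i)"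
  have M: "\<rho> (\<psi> e) \<in> carrier_mat d d" using rho_carrier psi e by auto
  have w': "w' T = (\<Sum>S\<in>ksets d k. w S * h (act (\<psi> e) (ext_unit S) T))"
    unfolding w_def w'_def act_def by (rule wedge_expansion_hom[OF h M p])
  have "w T = (\<Sum>S\<in>ksets d k. if T = S then w T else 0)"
    by (auto simp: w_def wedge_def)
  also have "\<dots> = (\<Sum>S\<in>ksets d k. w S * h (ext_unit S T))"
    by (intro sum.cong) (auto simp: ext_unit_def)
  finally have w: "w T = (\<Sum>S\<in>ksets d k. w S * h (ext_unit S T))" .
  have "xhat d k h \<rho> G \<psi> p e v T
      = (if tail G e = head G e then (if v = tail G e then w' T - w T else 0)
        else if v = tail G e then - w' T else if v = head G e then w T else 0)"
    by (simp add: xhat_def Let_def w_def w'_def)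
  also have "\<dots> = (\<Sum>S\<in>ksets d k. w S * h (edge_xvec e S v T))"
    unfolding w w' edge_xvec_def edge_vec_def
    by (auto simp: place_apply hom_minus hom_uminus sum_subtractf[symmetric] sum_negf[symmetric]
        algebra_simps intro!: sum.cong)
  finally show ?thesis by (simp add: w_def)
qed

text \<open>All vectors lie in the span of the image under \<open>h\<close> of a basis of the edge
  space, which has \<open>f_rep\<close> elements.\<close>

lemma card_le_f_rep:
  fixes h :: "'f \<Rightarrow> 'k::field"
  assumes h: "field_hom h" and X: "X \<subseteq> arcs G" "finite X"
    and p: "\<And>e i. e \<in> X \<Longrightarrow> i < k \<Longrightarrow> p e i \<in> carrier_vec d"
    and ind: "lin_indep_family (xhat d k h \<rho> G \<psi> p) X"
  shows "int (card X) \<le> f_rep \<Gamma> d k \<rho> G \<psi> X"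
proof -
  let ?x = "xhat d k h \<rho> G \<psi> p" and ?H = "\<lambda>b v S. h (b v S)"
  obtain B where B: "finite B" "fam.span B = edge_space X" "int (card B) = f_rep \<Gamma> d k \<rho> G \<psi> X"
    using edge_space_dim[OF X(2,1)] by blast
  have "?x e \<in> fam.span (?H ` B)" if e: "e \<in> X" for e
  proof -
    have "?x e = (\<Sum>S\<in>ksets d k. fam_scale (wedge d k (p e) S) (?H (edge_xvec e S)))"
      using X(1) e p by (auto simp: fun_eq_iff sum_fun_apply xhat_expansion[OF h])
    also have "\<dots> \<in> fam.span (?H ` B)"
    proof (intro fam.span_sum fam.span_scale)
      fix S assume "S \<in> ksets d k"
      then have "edge_vec e (ext_unit S) \<in> fam.span B"
        unfolding B(2) using e by (intro edge_vec_in_edge_space ext_unit_in_ext_power)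
      then have "edge_xvec e S \<in> fam.span B"
        using fam.span_neg by (simp only: edge_xvec_def split: if_split) blast
      then show "?H (edge_xvec e S) \<in> fam.span (?H ` B)" by (rule span_hom[OF h])
    qed
    finally show ?thesis .
  qed
  then have "?x ` X \<subseteq> fam.span (?H ` B)" by blast
  moreover have "inj_on ?x X" "fam.independent (?x ` X)"
    using ind lin_indep_family_iff[OF X(2)] by blast+
  ultimately have "card (?x ` X) \<le> card (?H ` B)"
    using fam.independent_span_bound[of "?H ` B" "?x ` X"] B(1) by simp
  also have "\<dots> \<le> card B" using B(1) by (rule card_image_le)
  finally show ?thesis
    using B(3) card_image[OF \<open>inj_on ?x X\<close>] by simp
qed

text \<open>Rado's theorem for the sets of all \<open>edge_xvec e S\<close>. Those of the edges in
  \<open>J\<close> generate the edge space of \<open>J\<close>, so the count is precisely the rank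
  condition.\<close>

lemma independent_unit_choice:
  assumes F: "F \<subseteq> arcs G" "finite F"
    and count: "\<And>X. X \<subseteq> F \<Longrightarrow> X \<noteq> {} \<Longrightarrow> int (card X) \<le> f_rep \<Gamma> d k \<rho> G \<psi> X"
  shows "\<exists>s. (\<forall>e\<in>F. s e \<in> ksets d k) \<and> lin_indep_family (\<lambda>e. edge_xvec e (s e)) F"
proof -
  let ?A = "\<lambda>e. edge_xvec e ` ksets d k"
  have "card J \<le> fam.dim (\<Union>e\<in>J. ?A e)" if J: "J \<subseteq> F" for J
  proof (cases "J = {}")
    case False
    have finJ: "finite J" and JG: "J \<subseteq> arcs G" using J F by (auto intro: finite_subset)
    obtain B where B: "fam.independent B" "fam.span B = edge_space J"
      "int (card B) = f_rep \<Gamma> d k \<rho> G \<psi> J"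
      using edge_space_dim[OF finJ JG] by blast
    have "fam.dim (edge_space J) = card B"
      using fam.dim_span_eq_card_independent[OF B(1)] B(2) by simp
    \<comment> \<open>The sign change at loops does not affect the span.\<close>
    moreover have "edge_space J \<subseteq> fam.span (\<Union>e\<in>J. ?A e)"
      unfolding edge_space_def
    proof (intro fam.span_minimal fam.subspace_span UN_least subsetI, elim imageE)
      fix e y z S assume eS: "e \<in> J" "y = edge_vec e z" "z = ext_unit S" "S \<in> ksets d k"
      then have "edge_xvec e S \<in> fam.span (\<Union>e\<in>J. ?A e)"
        by (intro fam.span_base) blast
      from this fam.span_neg[OF this] show "y \<in> fam.span (\<Union>e\<in>J. ?A e)"
        unfolding eS(2,3)
        by (cases "tail G e = head G e")
          (simp_all only: edge_xvec_def refl if_True if_False minus_minus)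
    qed
    ultimately have "card B \<le> fam.dim (\<Union>e\<in>J. ?A e)"
      using fam.dim_mono_finite[of "\<Union>e\<in>J. ?A e" "edge_space J"] finJ by simp
    then show ?thesis using count[OF J False] B(3) by linarith
  qed simp
  then obtain x where x: "\<forall>e\<in>F. x e \<in> ?A e" "inj_on x F" "fam.independent (x ` F)"
    using fam.rado_independent_transversal[OF F(2), of ?A] by auto
  then have "\<forall>e\<in>F. \<exists>S. S \<in> ksets d k \<and> x e = edge_xvec e S" by blast
  from bchoice[OF this] obtain s where s: "\<And>e. e \<in> F \<Longrightarrow> s e \<in> ksets d k \<and> x e = edge_xvec e (s e)"
    by blast
  have "lin_indep_family x F" using x lin_indep_family_iff[OF F(2)] by blast
  then have "lin_indep_family (\<lambda>e. edge_xvec e (s e)) F"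
    using lin_indep_family_cong[of F x "\<lambda>e. edge_xvec e (s e)"] s by blast
  then show ?thesis using s by blast
qed

text \<open>Specialising the generic coordinates to the unit vectors selected by
  \<open>independent_unit_choice\<close> yields an independent family, so the generic family is
  independent too.\<close>

lemma lin_indep_generic_xhat:
  fixes h :: "'f \<Rightarrow> 'k::field" and \<alpha> :: "'e \<times> nat \<times> nat \<Rightarrow> 'k"
  assumes h: "field_hom h" and A: "alg_indep h A" and F: "F \<subseteq> arcs G" "finite F"
    and inj: "inj_on \<alpha> (F \<times> {0..<k} \<times> {0..<d})" and ran: "\<alpha> ` (F \<times> {0..<k} \<times> {0..<d}) \<subseteq> A"
    and count: "\<And>X. X \<subseteq> F \<Longrightarrow> X \<noteq> {} \<Longrightarrow> int (card X) \<le> f_rep \<Gamma> d k \<rho> G \<psi> X"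
  shows "lin_indep_family (xhat d k h \<rho> G \<psi> (\<lambda>e i. vec d (\<lambda>l. \<alpha> (e, i, l)))) F"
proof -
  let ?p = "\<lambda>e i. vec d (\<lambda>l. \<alpha> (e, i, l))"
  interpret h: field_hom h by (rule h)
  interpret H: comm_ring_hom "poly_eval h :: _ \<Rightarrow> 'k"
    unfolding poly_eval_eq_mpoly_eval by (rule h.comm_ring_hom_mpoly_eval)
  interpret id: comm_ring_hom "id :: 'f \<Rightarrow> 'f" by unfold_locales auto
  obtain s where s: "\<And>e. e \<in> F \<Longrightarrow> s e \<in> ksets d k"
    and ind: "lin_indep_family (\<lambda>e. edge_xvec e (s e)) F"
    using independent_unit_choice[OF F count] by blast
  \<comment> \<open>The coordinates of a wedge of generic vectors, as polynomials in the elements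
    \<open>\<alpha> (e, j, l)\<close> viewed as indeterminates.\<close>
  define D where "D e S = det (mat k k (\<lambda>(i, j). mpoly_var (\<alpha> (e, j, pick S i))
      :: ('k \<Rightarrow>\<^sub>0 nat) \<Rightarrow>\<^sub>0 'f))" for e S
  \<comment> \<open>The expansion \<open>xhat_expansion\<close> with these polynomials in place of
    the wedge coordinates.\<close>
  define Q where "Q e v T = (\<Sum>S\<in>ksets d k. D e S * mpoly_const (edge_xvec e S v T))" for e v T
  \<comment> \<open>Turns vector \<open>i\<close> of edge \<open>e\<close> into the unit vector with
    index \<open>pick (s e) i\<close>. Injectivity of \<open>\<alpha>\<close> makes this well
    defined; values off its image are irrelevant.\<close>
  define \<sigma> where "\<sigma> a = (case the_inv_into (F \<times> {0..<k} \<times> {0..<d}) \<alpha> a of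
      (e, i, l) \<Rightarrow> if l = pick (s e) i then 1 else (0::'f))" for a
  interpret S: comm_ring_hom "mpoly_eval id \<sigma> :: _ \<Rightarrow> 'f"
    by (rule id.comm_ring_hom_mpoly_eval)
  have \<sigma>: "\<sigma> (\<alpha> (e, i, l)) = (if l = pick (s e) i then 1 else 0)" if "e \<in> F" "i < k" "l < d" for e i l
    using the_inv_into_f_f[OF inj, of "(e, i, l)"] that by (simp add: \<sigma>_def)
  have "poly_eval h (D e S) = wedge d k (?p e) S" if "S \<in> ksets d k" for e S
  proof -
    have "mat k k (\<lambda>(i, j). poly_eval h (mpoly_var (\<alpha> (e, j, pick S i))))
        = mat k k (\<lambda>(i, j). ?p e j $ pick S i)"
      using ksets_pick_less[OF that]
      by (intro eq_matI) (auto simp: poly_eval_eq_mpoly_eval)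
    then show ?thesis
      unfolding D_def H.det_mat_hom[symmetric] using that by (simp add: wedge_def)
  qed
  moreover have "poly_eval h (mpoly_const c) = h c" for c
    by (simp add: poly_eval_eq_mpoly_eval)
  ultimately have evalQ: "poly_eval h (Q e v T) = xhat d k h \<rho> G \<psi> ?p e v T" if "e \<in> F" for e v T
    using that F(1) xhat_expansion[OF h, of e ?p v T]
    by (auto simp: Q_def H.hom_sum H.hom_mult intro!: sum.cong)
  \<comment> \<open>At \<open>\<sigma>\<close> the wedge becomes the basis element of
    \<open>s e\<close>, so only the term of \<open>edge_xvec e (s e)\<close> survives in
    \<open>Q\<close>.\<close>
  have specD: "mpoly_eval id \<sigma> (D e S) = (if S = s e then 1 else 0)"
    if "e \<in> F" "S \<in> ksets d k" for e S
  proof -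
    have "mat k k (\<lambda>(i, j). mpoly_eval id \<sigma> (mpoly_var (\<alpha> (e, j, pick S i))))
        = mat k k (\<lambda>(i, j). unit_vec d (pick (s e) j) $ pick S i)"
      using ksets_pick_less[OF that(2)] ksets_pick_less[OF s[OF that(1)]] \<sigma>[OF that(1)]
      by (intro eq_matI) auto
    then have "mpoly_eval id \<sigma> (D e S) = wedge d k (\<lambda>j. unit_vec d (pick (s e) j)) S"
      unfolding D_def S.det_mat_hom[symmetric] using that(2) by (simp add: wedge_def)
    then show ?thesis by (simp only: wedge_unit_vecs[OF s[OF that(1)]])
  qed
  have "mpoly_eval id \<sigma> (Q e v T) = edge_xvec e (s e) v T" if e: "e \<in> F" for e v T
  proof -
    have "mpoly_eval id \<sigma> (Q e v T)
        = (\<Sum>S\<in>ksets d k. if S = s e then edge_xvec e (s e) v T else 0)"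
      unfolding Q_def S.hom_sum S.hom_mult id.mpoly_eval_const
      using specD[OF e] by (intro sum.cong) auto
    then show ?thesis using s[OF e] by simp
  qed
  then have "lin_indep_family (\<lambda>e v T. mpoly_eval id \<sigma> (Q e v T)) F"
    using ind lin_indep_family_cong[of F "\<lambda>e v T. mpoly_eval id \<sigma> (Q e v T)" "\<lambda>e. edge_xvec e (s e)"]
    by (simp add: fun_eq_iff)
  moreover have "finite ((tail G ` F \<union> head G ` F) \<times> ksets d k)"
    using F(2) by simp
  moreover have "Q e v T \<in> mpolys_in A" if "e \<in> F" for e v T
  proof -
    have "\<alpha> (e, j, pick S i) \<in> A" if "S \<in> ksets d k" "i < k" "j < k" for S i j
      using ran \<open>e \<in> F\<close> ksets_pick_less[OF that(1,2)] that(3) by (auto simp: image_subset_iff)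
    then show ?thesis
      unfolding Q_def D_def
      by (intro mpolys_in_sum mpolys_in_mult mpolys_in_const mpolys_in_det) (auto intro!: mpolys_in_var)
  qed
  moreover have "Q e v T = 0" if "e \<in> F" "(v, T) \<notin> (tail G ` F \<union> head G ` F) \<times> ksets d k" for e v T
  proof -
    have "edge_xvec e S v T = 0" if "S \<in> ksets d k" for S
      using \<open>e \<in> F\<close> \<open>(v, T) \<notin> _\<close> by (intro edge_xvec_supp[OF that]) auto
    then show ?thesis by (simp add: Q_def mpoly_const_def)
  qed
  ultimately have "lin_indep_family (\<lambda>e v T. poly_eval h (Q e v T)) F"
    using lin_indep_family_generic[OF h A F(2), of "(tail G ` F \<union> head G ` F) \<times> ksets d k" Q \<sigma>]
    by blast
  then show ?thesis
    using lin_indep_family_cong[of F "\<lambda>e v T. poly_eval h (Q e v T)" "xhat d k h \<rho> G \<psi> ?p"] evalQ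
    by (simp add: fun_eq_iff)
qed

end

theorem theorem7p1:
  fixes \<Gamma> :: "('g, 'c) monoid_scheme"
    and G :: "('v, 'e) pre_digraph"
    and \<psi> :: "'e \<Rightarrow> 'g"
    and \<rho> :: "'g \<Rightarrow> 'f::field mat"
    and h :: "'f \<Rightarrow> 'k::field"
    and A :: "'k set"
    and d k :: nat
  assumes "group \<Gamma>"
    and "\<rho> \<in> hom \<Gamma> (GL TYPE('f) d)"
    and "1 \<le> k" and "k \<le> d"
    and "fin_digraph G"
    and "\<psi> \<in> arcs G \<rightarrow> carrier \<Gamma>"
    and "field_hom h"
    and "alg_indep h A" and "finite A" and "card (arcs G) * k * d \<le> card A"
  shows "\<exists>p :: 'e \<Rightarrow> nat \<Rightarrow> 'k vec.
    (\<forall>e\<in>arcs G. \<forall>i<k. p e i \<in> carrier_vec d) \<and>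
    (\<forall>F. F \<subseteq> arcs G \<longrightarrow>
      (lin_indep_family (xhat d k h \<rho> G \<psi> p) F \<longleftrightarrow>
       (\<forall>X. X \<subseteq> F \<longrightarrow> X \<noteq> {} \<longrightarrow> int (card X) \<le> f_rep \<Gamma> d k \<rho> G \<psi> X)))"
proof -
  interpret gain_rep \<Gamma> d k \<rho> G \<psi>
    using assms(1,2,6) by (rule gain_rep.intro)
  have finE: "finite (arcs G)" using assms(5) by (rule fin_digraph.finite_arcs)
  let ?I = "arcs G \<times> {0..<k} \<times> {0..<d}"
  have "card ?I \<le> card A"
    using assms(10) by (simp add: card_cartesian_product mult.assoc)
  \<comment> \<open>A separate algebraically independent element for every coordinate of every
    attached vector.\<close>
  then obtain \<alpha> where \<alpha>: "\<alpha> ` ?I \<subseteq> A" "inj_on \<alpha> ?I"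
    using card_le_inj[of ?I A] finE assms(9) by auto
  \<comment> \<open>One choice of vectors serves all \<open>F\<close> at once: only the
    specialisation in \<open>lin_indep_generic_xhat\<close> depends on \<open>F\<close>.\<close>
  define p where "p = (\<lambda>e i. vec d (\<lambda>l. \<alpha> (e, i, l)))"
  have "lin_indep_family (xhat d k h \<rho> G \<psi> p) F \<longleftrightarrow>
      (\<forall>X. X \<subseteq> F \<longrightarrow> X \<noteq> {} \<longrightarrow> int (card X) \<le> f_rep \<Gamma> d k \<rho> G \<psi> X)" if F: "F \<subseteq> arcs G" for F
  proof
    have finF: "finite F" using F finE by (rule finite_subset)
    assume "lin_indep_family (xhat d k h \<rho> G \<psi> p) F"
    then show "\<forall>X. X \<subseteq> F \<longrightarrow> X \<noteq> {} \<longrightarrow> int (card X) \<le> f_rep \<Gamma> d k \<rho> G \<psi> X"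
      using F finF by (intro allI impI card_le_f_rep[OF assms(7)])
        (auto simp: p_def intro: lin_indep_family_subset finite_subset)
  next
    have finF: "finite F" using F finE by (rule finite_subset)
    have sub: "F \<times> {0..<k} \<times> {0..<d} \<subseteq> ?I" using F by blast
    assume count: "\<forall>X. X \<subseteq> F \<longrightarrow> X \<noteq> {} \<longrightarrow> int (card X) \<le> f_rep \<Gamma> d k \<rho> G \<psi> X"
    show "lin_indep_family (xhat d k h \<rho> G \<psi> p) F"
      unfolding p_def using count
      by (intro lin_indep_generic_xhat[OF assms(7,8) F finF inj_on_subset[OF \<alpha>(2) sub]
            order_trans[OF image_mono[OF sub] \<alpha>(1)]]) blast
  qed
  then show ?thesis
    by (intro exI[of _ p]) (auto simp: p_def)
qed

end
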